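(* Let $K$ be a field and let $E$ be a finite directed graph (with at least one vertex) in which every vertex is in at most one cycle. Then the Leavitt path algebra $L_K(E)$ (with its standard $\mathbb{Z}$-grading) has gr-IBN.
   Context: A directed graph $E=(E^0,E^1,s,r)$ consists of disjoint sets $E^0$ (vertices) and $E^1$ (edges) with maps $s,r:E^1\to E^0$ (source, range). It is finite if $E^0$ and $E^1$ are finite. A vertex $v$ is regular if $0<|s^{-1}(v)|<\infty$. A path is a sequence of edges $p=e_1\cdots e_n$ with $r(e_i)=s(e_{i+1})$. If $p$ is closed ($s(e_1)=r(e_n)$) and the vertices $s(e_1),\dots,s(e_n)$ are distinct, the subgraph formed by these vertices and edges is a cycle (so cyclic permutations of $p$ give the same cycle). The Leavitt path algebra $L_K(E)$ is the $K$-algebra generated by $E^0\cup E^1\cup\{e^*\mid e\in E^1\}$ subject to, for all $v,w\in E^0$ and $e,f\in E^1$: (1) $vw=\delta_{v,w}w$; (2) $s(e)e=e=er(e)$ and $r(e)e^*=e^*=e^*s(e)$; (3) $e^*f=\delta_{e,f}r(e)$; (4) $v=\sum_{e\in s^{-1}(v)}ee^*$ for every regular vertex $v$. It is $\mathbb{Z}$-graded with $\deg v=0$, $\deg e=1$, $\deg e^*=-1$. For an abelian group $\Gamma$, a $\Gamma$-graded ring $R$ and $\delta\in\Gamma$, the shifted graded right module $R(\delta)$ has components $R(\delta)_\gamma=R_{\delta+\gamma}$; $\cong_{gr}$ denotes isomorphism of right modules preserving degrees. $R$ has gr-IBN (Graded Invariant Basis Number) if for all positive integers $m,n$ and all $\alpha_1,\dots,\alpha_m,\beta_1,\dots,\beta_n\in\Gamma$,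 $R(\alpha_1)\oplus\cdots\oplus R(\alpha_m)\cong_{gr}R(\beta_1)\oplus\cdots\oplus R(\beta_n)$ as graded right $R$-modules implies $m=n$. *)

theory Defs
  imports "HOL-Algebra.Ideal" "HOL-Library.Poly_Mapping" "Graph_Theory.Arc_Walk"
begin

section \<open>Graded rings, graded right modules and gr-IBN\<close>

locale graded_ring = ring R for R (structure) +
  fixes A :: "'g::ab_group_add \<Rightarrow> 'a set"
  assumes component_subgroup: "additive_subgroup (A \<gamma>) R"
    and component_mult: "\<lbrakk>x \<in> A \<gamma>; y \<in> A \<delta>\<rbrakk> \<Longrightarrow> x \<otimes> y \<in> A (\<gamma> + \<delta>)"
    and direct_decomposition:
      "x \<in> carrier R \<Longrightarrow>
        \<exists>!c. (\<forall>\<gamma>. c \<gamma> \<in> A \<gamma>) \<and> finite {\<gamma>. c \<gamma> \<noteq> \<zero>} \<and> x = finsum R c {\<gamma>. c \<gamma> \<noteq> \<zero>}"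

text \<open>As for \<^const>\<open>ring\<close>-based modules in the library, a module inherits its additive
  structure from the ring record; the fields \<^const>\<open>monoid.mult\<close> and \<^const>\<open>one\<close> play no role.
  The action is written \<open>ract M x r\<close> for \<open>x \<cdot> r\<close>.\<close>

record ('r, 'g, 'm) gr_right_module = "'m ring" +
  ract :: "'m \<Rightarrow> 'r \<Rightarrow> 'm"
  component :: "'g \<Rightarrow> 'm set"

definition regular_gr_module ::
  "('r, 'x) ring_scheme \<Rightarrow> ('g \<Rightarrow> 'r set) \<Rightarrow> ('r, 'g, 'r) gr_right_module" where
  "regular_gr_module R A =
    \<lparr>carrier = carrier R, monoid.mult = monoid.mult R, one = one R,
     zero = zero R, add = add R, ract = monoid.mult R, component = A\<rparr>"

definition gr_shift ::
  "'g::ab_group_add \<Rightarrow> ('r, 'g, 'm) gr_right_module \<Rightarrow> ('r, 'g, 'm) gr_right_module" where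
  "gr_shift \<delta> M = M\<lparr>component := \<lambda>\<gamma>. component M (\<delta> + \<gamma>)\<rparr>"

definition gr_direct_sum ::
  "nat \<Rightarrow> (nat \<Rightarrow> ('r, 'g, 'm) gr_right_module) \<Rightarrow> ('r, 'g, nat \<Rightarrow> 'm) gr_right_module" where
  "gr_direct_sum n M =
    \<lparr>carrier = \<Pi>\<^sub>E i\<in>{..<n}. carrier (M i),
     monoid.mult = (\<lambda>x y. \<lambda>i\<in>{..<n}. x i \<otimes>\<^bsub>M i\<^esub> y i),
     one = (\<lambda>i\<in>{..<n}. \<one>\<^bsub>M i\<^esub>),
     zero = (\<lambda>i\<in>{..<n}. \<zero>\<^bsub>M i\<^esub>),
     add = (\<lambda>x y. \<lambda>i\<in>{..<n}. x i \<oplus>\<^bsub>M i\<^esub> y i),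
     ract = (\<lambda>x r. \<lambda>i\<in>{..<n}. ract (M i) (x i) r),
     component = (\<lambda>\<gamma>. \<Pi>\<^sub>E i\<in>{..<n}. component (M i) \<gamma>)\<rparr>"

definition gr_module_iso ::
  "('r, 'x) ring_scheme \<Rightarrow> ('r, 'g, 'm) gr_right_module \<Rightarrow> ('r, 'g, 'n) gr_right_module
    \<Rightarrow> ('m \<Rightarrow> 'n) \<Rightarrow> bool" where
  "gr_module_iso R M N f \<longleftrightarrow>
    bij_betw f (carrier M) (carrier N) \<and>
    (\<forall>x\<in>carrier M. \<forall>y\<in>carrier M. f (x \<oplus>\<^bsub>M\<^esub> y) = f x \<oplus>\<^bsub>N\<^esub> f y) \<and>
    (\<forall>x\<in>carrier M. \<forall>r\<in>carrier R. f (ract M x r) = ract N (f x) r) \<and>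
    (\<forall>\<gamma>. f ` component M \<gamma> \<subseteq> component N \<gamma>)"

definition gr_isomorphic ::
  "('r, 'x) ring_scheme \<Rightarrow> ('r, 'g, 'm) gr_right_module \<Rightarrow> ('r, 'g, 'n) gr_right_module
    \<Rightarrow> bool" where
  "gr_isomorphic R M N \<longleftrightarrow> (\<exists>f. gr_module_iso R M N f)"

definition gr_IBN :: "('r, 'x) ring_scheme \<Rightarrow> ('g::ab_group_add \<Rightarrow> 'r set) \<Rightarrow> bool" where
  "gr_IBN R A \<longleftrightarrow>
    (\<forall>m n (\<alpha> :: nat \<Rightarrow> 'g) (\<beta> :: nat \<Rightarrow> 'g). 0 < m \<longrightarrow> 0 < n \<longrightarrow>
      gr_isomorphic R
        (gr_direct_sum m (\<lambda>i. gr_shift (\<alpha> i) (regular_gr_module R A)))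
        (gr_direct_sum n (\<lambda>i. gr_shift (\<beta> i) (regular_gr_module R A))) \<longrightarrow>
      m = n)"


section \<open>Free associative algebras\<close>

datatype 'x fword = Word (letters: "'x list")

instantiation fword :: (type) monoid_add
begin

definition zero_fword :: "'a fword" where "0 = Word []"

definition plus_fword :: "'a fword \<Rightarrow> 'a fword \<Rightarrow> 'a fword" where
  "u + w = Word (letters u @ letters w)"

instance by standard (auto simp: zero_fword_def plus_fword_def)

end

text \<open>Multiplication on \<^typ>\<open>'x fword \<Rightarrow>\<^sub>0 'k\<close> is convolution with respect to
  concatenation, so this type is the unital free algebra on \<^typ>\<open>'x\<close>, and \<open>single 0 c * p\<close> is
  the scalar multiple of \<open>p\<close> by \<open>c\<close>. Excluding the empty word gives the non-unital free algebra
  on \<open>X\<close>. This matters below: imposing the Leavitt path relations on the unital free algebra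
  instead would add a spurious factor \<open>K\<close>.\<close>

definition free_algebra :: "'x set \<Rightarrow> ('x fword \<Rightarrow>\<^sub>0 'k::field) set" where
  "free_algebra X =
    {p. \<forall>w\<in>Poly_Mapping.keys p. letters w \<noteq> [] \<and> set (letters w) \<subseteq> X}"

definition gen :: "'x \<Rightarrow> ('x fword \<Rightarrow>\<^sub>0 'k::field)" where
  "gen x = Poly_Mapping.single (Word [x]) 1"

definition algebra_ideal ::
  "('x fword \<Rightarrow>\<^sub>0 'k::field) set \<Rightarrow> ('x fword \<Rightarrow>\<^sub>0 'k) set \<Rightarrow> bool" where
  "algebra_ideal F I \<longleftrightarrow>
    I \<subseteq> F \<and> 0 \<in> I \<and>
    (\<forall>p\<in>I. \<forall>q\<in>I. p + q \<in> I) \<and>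
    (\<forall>c. \<forall>p\<in>I. Poly_Mapping.single 0 c * p \<in> I) \<and>
    (\<forall>a\<in>F. \<forall>p\<in>I. a * p \<in> I \<and> p * a \<in> I)"


section \<open>Leavitt path algebras\<close>

datatype ('a, 'b) lpa_gen = Vertex 'a | Edge 'b | Ghost 'b

type_synonym ('a, 'b, 'k) lpa_free = "('a, 'b) lpa_gen fword \<Rightarrow>\<^sub>0 'k"

definition lpa_gens :: "('a, 'b) pre_digraph \<Rightarrow> ('a, 'b) lpa_gen set" where
  "lpa_gens E = Vertex ` verts E \<union> Edge ` arcs E \<union> Ghost ` arcs E"

definition regular_vertex :: "('a, 'b) pre_digraph \<Rightarrow> 'a \<Rightarrow> bool" where
  "regular_vertex E v \<longleftrightarrow> v \<in> verts E \<and> out_arcs E v \<noteq> {} \<and> finite (out_arcs E v)"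

inductive_set lpa_relators :: "('a, 'b) pre_digraph \<Rightarrow> ('a, 'b, 'k::field) lpa_free set"
  for E :: "('a, 'b) pre_digraph" where
  vertex_vertex: "\<lbrakk>v \<in> verts E; w \<in> verts E\<rbrakk> \<Longrightarrow>
    gen (Vertex v) * gen (Vertex w) - (if v = w then gen (Vertex w) else 0) \<in> lpa_relators E"
| tail_edge: "e \<in> arcs E \<Longrightarrow>
    gen (Vertex (tail E e)) * gen (Edge e) - gen (Edge e) \<in> lpa_relators E"
| edge_head: "e \<in> arcs E \<Longrightarrow>
    gen (Edge e) * gen (Vertex (head E e)) - gen (Edge e) \<in> lpa_relators E"
| head_ghost: "e \<in> arcs E \<Longrightarrow>
    gen (Vertex (head E e)) * gen (Ghost e) - gen (Ghost e) \<in> lpa_relators E"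
| ghost_tail: "e \<in> arcs E \<Longrightarrow>
    gen (Ghost e) * gen (Vertex (tail E e)) - gen (Ghost e) \<in> lpa_relators E"
| ghost_edge: "\<lbrakk>e \<in> arcs E; f \<in> arcs E\<rbrakk> \<Longrightarrow>
    gen (Ghost e) * gen (Edge f) - (if e = f then gen (Vertex (head E e)) else 0)
      \<in> lpa_relators E"
| regular: "regular_vertex E v \<Longrightarrow>
    gen (Vertex v) - (\<Sum>e\<in>out_arcs E v. gen (Edge e) * gen (Ghost e)) \<in> lpa_relators E"

definition lpa_ideal :: "('a, 'b) pre_digraph \<Rightarrow> ('a, 'b, 'k::field) lpa_free set" where
  "lpa_ideal E = algebra_ideal (free_algebra (lpa_gens E)) hull lpa_relators E"

definition lpa_class ::
  "('a, 'b) pre_digraph \<Rightarrow> ('a, 'b, 'k::field) lpa_free \<Rightarrow> ('a, 'b, 'k) lpa_free set" where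
  "lpa_class E p = {q \<in> free_algebra (lpa_gens E). q - p \<in> lpa_ideal E}"

text \<open>The quotient of the free algebra by the ideal generated by the relators. When \<open>verts E\<close> is
  finite it has a unit, the sum of all vertices; \<^const>\<open>one\<close> is meaningful only in this case.\<close>

definition leavitt_path_algebra ::
  "'k::field itself \<Rightarrow> ('a, 'b) pre_digraph \<Rightarrow> ('a, 'b, 'k) lpa_free set ring" where
  "leavitt_path_algebra _ E =
    \<lparr>carrier = lpa_class E ` free_algebra (lpa_gens E),
     monoid.mult = (\<lambda>X Y. \<Union>p\<in>X. \<Union>q\<in>Y. lpa_class E (p * q)),
     one = lpa_class E (\<Sum>v\<in>verts E. gen (Vertex v)),
     zero = lpa_class E 0,
     add = (\<lambda>X Y. \<Union>p\<in>X. \<Union>q\<in>Y. lpa_class E (p + q))\<rparr>"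

primrec gen_deg :: "('a, 'b) lpa_gen \<Rightarrow> int" where
  "gen_deg (Vertex v) = 0"
| "gen_deg (Edge e) = 1"
| "gen_deg (Ghost e) = -1"

definition word_deg :: "('a, 'b) lpa_gen fword \<Rightarrow> int" where
  "word_deg w = sum_list (map gen_deg (letters w))"

definition lpa_component ::
  "'k::field itself \<Rightarrow> ('a, 'b) pre_digraph \<Rightarrow> int \<Rightarrow> ('a, 'b, 'k) lpa_free set set" where
  "lpa_component _ E n =
    lpa_class E ` {p \<in> free_algebra (lpa_gens E). \<forall>w\<in>Poly_Mapping.keys p. word_deg w = n}"


section \<open>Cycles\<close>

text \<open>A cycle is a subgraph, so the rotations of a closed walk yield the same cycle. In a closed
  walk starting at \<open>u\<close>, \<open>tl (awalk_verts u p)\<close> is a rotation of the list of tails, so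
  \<^const>\<open>pre_digraph.cycle\<close> requires exactly that the tails are distinct; loops are cycles.\<close>

definition cycle_subgraphs :: "('a, 'b) pre_digraph \<Rightarrow> ('a, 'b) pre_digraph set" where
  "cycle_subgraphs E =
    {\<lparr>verts = tail E ` set p, arcs = set p, tail = tail E, head = head E\<rparr> | p.
      pre_digraph.cycle E p}"

section \<open>The Leavitt path algebra of a finite graph is a graded unital ring\<close>

lemma UN_UN_constant:
  assumes "a \<in> A" "b \<in> B" "\<And>x y. x \<in> A \<Longrightarrow> y \<in> B \<Longrightarrow> f x y = c"
  shows "(\<Union>x\<in>A. \<Union>y\<in>B. f x y) = c"
proof -
  have "(\<Union>x\<in>A. \<Union>y\<in>B. f x y) = (\<Union>x\<in>A. \<Union>y\<in>B. c)"
    using assms(3) by (intro SUP_cong refl)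
  then show ?thesis using assms(1,2) by auto
qed

lemma poly_mapping_sum_single:
  fixes p :: "'x \<Rightarrow>\<^sub>0 'k::comm_monoid_add"
  shows "p = (\<Sum>w\<in>Poly_Mapping.keys p. Poly_Mapping.single w (Poly_Mapping.lookup p w))"
proof (rule poly_mapping_eqI)
  fix u
  have "(\<Sum>w\<in>Poly_Mapping.keys p. Poly_Mapping.lookup (Poly_Mapping.single w (Poly_Mapping.lookup p w)) u)
      = (\<Sum>w\<in>Poly_Mapping.keys p. if w = u then Poly_Mapping.lookup p w else 0)"
    by (intro sum.cong) (auto simp: lookup_single when_def)
  also have "\<dots> = Poly_Mapping.lookup p u"
    by (simp add: in_keys_iff)
  finally show "Poly_Mapping.lookup p u = Poly_Mapping.lookup
      (\<Sum>w\<in>Poly_Mapping.keys p. Poly_Mapping.single w (Poly_Mapping.lookup p w)) u"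
    by (simp add: lookup_sum)
qed

lemma free_algebra_single [intro]:
  "letters w \<noteq> [] \<Longrightarrow> set (letters w) \<subseteq> X \<Longrightarrow> Poly_Mapping.single w c \<in> free_algebra X"
  by (simp add: free_algebra_def)

lemma free_algebra_gen: "x \<in> X \<Longrightarrow> gen x \<in> free_algebra X"
  unfolding gen_def by (rule free_algebra_single) simp_all

lemma free_algebra_zero: "0 \<in> free_algebra X"
  by (simp add: free_algebra_def)

lemma free_algebra_add: "p \<in> free_algebra X \<Longrightarrow> q \<in> free_algebra X \<Longrightarrow> p + q \<in> free_algebra X"
  using keys_add[of p q] by (auto simp: free_algebra_def)

lemma free_algebra_uminus: "p \<in> free_algebra X \<Longrightarrow> - p \<in> free_algebra X"
  by (simp add: free_algebra_def in_keys_iff)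

lemma free_algebra_diff: "p \<in> free_algebra X \<Longrightarrow> q \<in> free_algebra X \<Longrightarrow> p - q \<in> free_algebra X"
  using free_algebra_add[OF _ free_algebra_uminus, of p X q] by simp

lemma free_algebra_mult: "p \<in> free_algebra X \<Longrightarrow> q \<in> free_algebra X \<Longrightarrow> p * q \<in> free_algebra X"
  using keys_mult[of p q] by (fastforce simp: free_algebra_def plus_fword_def)

lemma free_algebra_scale: "p \<in> free_algebra X \<Longrightarrow> Poly_Mapping.single 0 c * p \<in> free_algebra X"
  using keys_mult[of "Poly_Mapping.single 0 c" p]
  by (fastforce simp: free_algebra_def plus_fword_def zero_fword_def split: if_splits)

lemma free_algebra_sum:
  "(\<And>i. i \<in> S \<Longrightarrow> f i \<in> free_algebra X) \<Longrightarrow> (\<Sum>i\<in>S. f i) \<in> free_algebra X"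
  by (induction S rule: infinite_finite_induct) (auto intro: free_algebra_zero free_algebra_add)

lemmas free_algebra_intros =
  free_algebra_gen free_algebra_zero free_algebra_add free_algebra_uminus free_algebra_diff
  free_algebra_mult free_algebra_scale free_algebra_sum

lemma algebra_ideal_free_algebra: "algebra_ideal (free_algebra X) (free_algebra X)"
  by (auto simp: algebra_ideal_def intro: free_algebra_intros)

lift_definition homog_part :: "int \<Rightarrow> ('a, 'b, 'k::zero) lpa_free \<Rightarrow> ('a, 'b, 'k) lpa_free"
  is "\<lambda>n f w. if word_deg w = n then f w else 0"
  by (erule finite_subset[rotated]) (auto split: if_splits)

lemma lookup_homog_part:
  "Poly_Mapping.lookup (homog_part n p) w = (if word_deg w = n then Poly_Mapping.lookup p w else 0)"
  by transfer simp

lemma keys_homog_part: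
  "Poly_Mapping.keys (homog_part n p) = {w \<in> Poly_Mapping.keys p. word_deg w = n}"
  by (auto simp: in_keys_iff lookup_homog_part split: if_splits)

lemma homog_part_zero [simp]: "homog_part n 0 = 0"
  by (rule poly_mapping_eqI) (simp add: lookup_homog_part)

lemma homog_part_add:
  fixes p q :: "('a, 'b, 'k::comm_monoid_add) lpa_free"
  shows "homog_part n (p + q) = homog_part n p + homog_part n q"
  by (rule poly_mapping_eqI) (simp add: lookup_homog_part lookup_add)

lemma homog_part_diff:
  fixes p q :: "('a, 'b, 'k::ab_group_add) lpa_free"
  shows "homog_part n (p - q) = homog_part n p - homog_part n q"
  by (rule poly_mapping_eqI) (simp add: lookup_homog_part lookup_minus)

lemma homog_part_sum:
  fixes f :: "'i \<Rightarrow> ('a, 'b, 'k::comm_monoid_add) lpa_free"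
  shows "homog_part n (\<Sum>i\<in>S. f i) = (\<Sum>i\<in>S. homog_part n (f i))"
  by (induction S rule: infinite_finite_induct) (simp_all add: homog_part_add)

lemma homog_part_single:
  "homog_part n (Poly_Mapping.single w c) = (if word_deg w = n then Poly_Mapping.single w c else 0)"
  by (rule poly_mapping_eqI) (auto simp: lookup_homog_part lookup_single when_def)

lemma word_deg_plus: "word_deg (u + w) = word_deg u + word_deg w"
  by (simp add: word_deg_def plus_fword_def)

lemma homog_part_single_mult:
  fixes p :: "('a, 'b, 'k::field) lpa_free"
  shows "homog_part n (Poly_Mapping.single u c * p)
    = Poly_Mapping.single u c * homog_part (n - word_deg u) p"
proof -
  let ?s = "\<lambda>w. Poly_Mapping.single w (Poly_Mapping.lookup p w)"
  have p: "p = (\<Sum>w\<in>Poly_Mapping.keys p. ?s w)" by (rule poly_mapping_sum_single)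
  have *: "homog_part n (Poly_Mapping.single u c * ?s w)
      = Poly_Mapping.single u c * homog_part (n - word_deg u) (?s w)" for w
    by (auto simp: mult_single homog_part_single word_deg_plus)
  show ?thesis
    by (subst (1 2) p) (simp only: sum_distrib_left homog_part_sum *)
qed

lemma homog_part_mult_single:
  fixes p :: "('a, 'b, 'k::field) lpa_free"
  shows "homog_part n (p * Poly_Mapping.single u c)
    = homog_part (n - word_deg u) p * Poly_Mapping.single u c"
proof -
  let ?s = "\<lambda>w. Poly_Mapping.single w (Poly_Mapping.lookup p w)"
  have p: "p = (\<Sum>w\<in>Poly_Mapping.keys p. ?s w)" by (rule poly_mapping_sum_single)
  have *: "homog_part n (?s w * Poly_Mapping.single u c)
      = homog_part (n - word_deg u) (?s w) * Poly_Mapping.single u c" for w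
    by (auto simp: mult_single homog_part_single word_deg_plus)
  show ?thesis
    by (subst (1 2) p) (simp only: sum_distrib_right homog_part_sum *)
qed

lemma homog_part_gen [simp]: "homog_part n (gen x) = (if gen_deg x = n then gen x else 0)"
  by (simp add: gen_def homog_part_single word_deg_def)

lemma homog_part_gen_mult [simp]:
  "homog_part n (gen x * gen y) = (if gen_deg x + gen_deg y = n then gen x * gen y else 0)"
  by (simp add: gen_def mult_single homog_part_single word_deg_def plus_fword_def)

lemma homog_part_free_algebra:
  "p \<in> free_algebra X \<Longrightarrow> homog_part n p \<in> free_algebra X"
  by (auto simp: free_algebra_def keys_homog_part)

lemma homog_part_same:
  "(\<And>w. w \<in> Poly_Mapping.keys p \<Longrightarrow> word_deg w = n) \<Longrightarrow>
    homog_part m p = (if m = n then p else 0)"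
  by (rule poly_mapping_eqI) (auto simp: lookup_homog_part in_keys_iff)

lemma homog_part_decomp:
  fixes p :: "('a, 'b, 'k::comm_monoid_add) lpa_free"
  assumes "finite S" "word_deg ` Poly_Mapping.keys p \<subseteq> S"
  shows "p = (\<Sum>n\<in>S. homog_part n p)"
proof (rule poly_mapping_eqI)
  fix w
  have "(\<Sum>n\<in>S. Poly_Mapping.lookup (homog_part n p) w)
      = (if word_deg w \<in> S then Poly_Mapping.lookup p w else 0)"
    using assms(1) by (simp add: lookup_homog_part)
  also have "\<dots> = Poly_Mapping.lookup p w"
    using assms(2) by (auto simp: in_keys_iff image_subset_iff)
  finally show "Poly_Mapping.lookup p w = Poly_Mapping.lookup (\<Sum>n\<in>S. homog_part n p) w"
    by (simp add: lookup_sum)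
qed

context fin_digraph
begin

abbreviation FG :: "('a, 'b, 'k::field) lpa_free set" where
  "FG \<equiv> free_algebra (lpa_gens G)"

abbreviation IG :: "('a, 'b, 'k::field) lpa_free set" where
  "IG \<equiv> lpa_ideal G"

lemma lpa_gens_intros:
  "v \<in> verts G \<Longrightarrow> Vertex v \<in> lpa_gens G"
  "e \<in> arcs G \<Longrightarrow> Edge e \<in> lpa_gens G"
  "e \<in> arcs G \<Longrightarrow> Ghost e \<in> lpa_gens G"
  by (auto simp: lpa_gens_def)

lemma lpa_relators_subset: "lpa_relators G \<subseteq> FG"
proof
  fix p assume "p \<in> lpa_relators G"
  then show "p \<in> FG"
    by cases (auto intro!: free_algebra_intros lpa_gens_intros simp: regular_vertex_def)
qed

lemma algebra_ideal_lpa: "algebra_ideal FG IG"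
proof -
  let ?M = "{T. algebra_ideal FG T \<and> lpa_relators G \<subseteq> T} :: ('a, 'b, 'k::field) lpa_free set set"
  have M: "FG \<in> ?M"
    using lpa_relators_subset algebra_ideal_free_algebra by auto
  have "algebra_ideal FG (\<Inter>?M)"
    unfolding algebra_ideal_def[of _ "\<Inter>?M"]
  proof (intro conjI)
    show "\<Inter>?M \<subseteq> FG" using M by (rule Inter_lower)
  qed (simp_all add: algebra_ideal_def)
  then show ?thesis by (simp only: lpa_ideal_def hull_def)
qed

lemma ideal_subset: "p \<in> IG \<Longrightarrow> p \<in> FG"
  and ideal_zero: "0 \<in> IG"
  and ideal_add: "p \<in> IG \<Longrightarrow> q \<in> IG \<Longrightarrow> p + q \<in> IG"
  and ideal_scale: "p \<in> IG \<Longrightarrow> Poly_Mapping.single 0 c * p \<in> IG"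
  and ideal_mult_left: "a \<in> FG \<Longrightarrow> p \<in> IG \<Longrightarrow> a * p \<in> IG"
  and ideal_mult_right: "a \<in> FG \<Longrightarrow> p \<in> IG \<Longrightarrow> p * a \<in> IG"
  using algebra_ideal_lpa by (auto simp: algebra_ideal_def)

lemma ideal_uminus: "p \<in> IG \<Longrightarrow> - p \<in> IG"
  using ideal_scale[of p "-1"] by (simp add: single_uminus)

lemma ideal_diff: "p \<in> IG \<Longrightarrow> q \<in> IG \<Longrightarrow> p - q \<in> IG"
  using ideal_add[OF _ ideal_uminus, of p q] by simp

lemma ideal_sum: "(\<And>i. i \<in> S \<Longrightarrow> f i \<in> IG) \<Longrightarrow> (\<Sum>i\<in>S. f i) \<in> IG"
  by (induction S rule: infinite_finite_induct) (auto intro: ideal_zero ideal_add)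

lemma ideal_relator: "p \<in> lpa_relators G \<Longrightarrow> p \<in> IG"
  unfolding lpa_ideal_def by (rule hull_inc)

lemma ideal_trans: "p - q \<in> IG \<Longrightarrow> q - r \<in> IG \<Longrightarrow> p - r \<in> IG"
  using ideal_add[of "p - q" "q - r"] by simp

lemma ideal_sym: "p - q \<in> IG \<Longrightarrow> q - p \<in> IG"
  using ideal_uminus[of "p - q"] by simp

lemma lpa_class_eq_iff:
  assumes "p \<in> FG" "q \<in> FG"
  shows "lpa_class G p = lpa_class G q \<longleftrightarrow> p - q \<in> IG"
proof
  assume "lpa_class G p = lpa_class G q"
  moreover have "p \<in> lpa_class G p" using assms ideal_zero by (simp add: lpa_class_def)
  ultimately show "p - q \<in> IG" by (simp add: lpa_class_def)
next
  assume "p - q \<in> IG"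
  then show "lpa_class G p = lpa_class G q"
    by (auto simp: lpa_class_def intro: ideal_trans ideal_sym)
qed

lemma lpa_class_self: "p \<in> FG \<Longrightarrow> p \<in> lpa_class G p"
  using ideal_zero by (simp add: lpa_class_def)

lemma lpa_class_add:
  assumes "p \<in> FG" "q \<in> FG"
  shows "lpa_class G p \<oplus>\<^bsub>leavitt_path_algebra TYPE('k::field) G\<^esub> lpa_class G q = lpa_class G (p + q)"
proof -
  have "lpa_class G (p' + q') = lpa_class G (p + q)"
    if "p' \<in> lpa_class G p" "q' \<in> lpa_class G q" for p' q'
  proof -
    have "(p' - p) + (q' - q) \<in> IG"
      using that by (simp add: lpa_class_def ideal_add)
    also have "(p' - p) + (q' - q) = (p' + q') - (p + q)" by simp
    finally have "p' + q' - (p + q) \<in> IG" .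
    moreover have "p' \<in> FG" "q' \<in> FG" using that by (simp_all add: lpa_class_def)
    ultimately show ?thesis
      using assms by (simp only: lpa_class_eq_iff free_algebra_add)
  qed
  then have "(\<Union>p'\<in>lpa_class G p. \<Union>q'\<in>lpa_class G q. lpa_class G (p' + q')) = lpa_class G (p + q)"
    by (rule UN_UN_constant[OF lpa_class_self[OF assms(1)] lpa_class_self[OF assms(2)]])
  then show ?thesis by (simp add: leavitt_path_algebra_def)
qed

lemma lpa_class_mult:
  assumes "p \<in> FG" "q \<in> FG"
  shows "lpa_class G p \<otimes>\<^bsub>leavitt_path_algebra TYPE('k::field) G\<^esub> lpa_class G q = lpa_class G (p * q)"
proof -
  have "lpa_class G (p' * q') = lpa_class G (p * q)"
    if "p' \<in> lpa_class G p" "q' \<in> lpa_class G q" for p' q'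
  proof -
    have "(p' - p) * q' + p * (q' - q) \<in> IG"
      using that assms unfolding lpa_class_def
      by (intro ideal_add[OF ideal_mult_right ideal_mult_left]) simp_all
    also have "(p' - p) * q' + p * (q' - q) = p' * q' - p * q" by (simp add: algebra_simps)
    finally have "p' * q' - p * q \<in> IG" .
    moreover have "p' \<in> FG" "q' \<in> FG" using that by (simp_all add: lpa_class_def)
    ultimately show ?thesis
      using assms by (simp only: lpa_class_eq_iff free_algebra_mult)
  qed
  then have "(\<Union>p'\<in>lpa_class G p. \<Union>q'\<in>lpa_class G q. lpa_class G (p' * q')) = lpa_class G (p * q)"
    by (rule UN_UN_constant[OF lpa_class_self[OF assms(1)] lpa_class_self[OF assms(2)]])
  then show ?thesis by (simp add: leavitt_path_algebra_def)
qed

lemma lpa_carrier: "carrier (leavitt_path_algebra TYPE('k::field) G) = lpa_class G ` FG"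
  and lpa_zero: "\<zero>\<^bsub>leavitt_path_algebra TYPE('k::field) G\<^esub> = lpa_class G 0"
  and lpa_one: "\<one>\<^bsub>leavitt_path_algebra TYPE('k::field) G\<^esub> = lpa_class G (\<Sum>v\<in>verts G. gen (Vertex v))"
  by (simp_all add: leavitt_path_algebra_def)

abbreviation vsum :: "('a, 'b, 'k::field) lpa_free" where
  "vsum \<equiv> \<Sum>v\<in>verts G. gen (Vertex v)"

lemma vsum_free: "vsum \<in> FG"
  by (intro free_algebra_intros lpa_gens_intros)

lemma vsum_vertex:
  assumes "w \<in> verts G"
  shows "vsum * gen (Vertex w) - gen (Vertex w) \<in> (IG :: ('a, 'b, 'k::field) lpa_free set)"
    and "gen (Vertex w) * vsum - gen (Vertex w) \<in> (IG :: ('a, 'b, 'k::field) lpa_free set)"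
proof -
  have d: "gen (Vertex w) = (\<Sum>v\<in>verts G. if v = w then gen (Vertex w) else 0 :: ('a, 'b, 'k) lpa_free)"
    and d': "gen (Vertex w) = (\<Sum>v\<in>verts G. if w = v then gen (Vertex v) else 0 :: ('a, 'b, 'k) lpa_free)"
    using assms by simp_all
  have "vsum * gen (Vertex w) - gen (Vertex w) =
      (\<Sum>v\<in>verts G. gen (Vertex v) * gen (Vertex w) - (if v = w then gen (Vertex w) else 0 :: ('a, 'b, 'k) lpa_free))"
    by (subst (2) d) (simp add: sum_subtractf sum_distrib_right)
  then show "vsum * gen (Vertex w) - gen (Vertex w) \<in> (IG :: ('a, 'b, 'k::field) lpa_free set)"
    using assms by (metis (no_types, lifting) ideal_sum ideal_relator lpa_relators.vertex_vertex)
  have "gen (Vertex w) * vsum - gen (Vertex w) =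
      (\<Sum>v\<in>verts G. gen (Vertex w) * gen (Vertex v) - (if w = v then gen (Vertex v) else 0 :: ('a, 'b, 'k) lpa_free))"
    by (subst (2) d') (simp add: sum_subtractf sum_distrib_left)
  then show "gen (Vertex w) * vsum - gen (Vertex w) \<in> (IG :: ('a, 'b, 'k::field) lpa_free set)"
    using assms by (metis (no_types, lifting) ideal_sum ideal_relator lpa_relators.vertex_vertex)
qed

lemma vsum_gen:
  assumes "x \<in> lpa_gens G"
  shows "vsum * gen x - gen x \<in> (IG :: ('a, 'b, 'k::field) lpa_free set)" and "gen x * vsum - gen x \<in> (IG :: ('a, 'b, 'k::field) lpa_free set)"
proof -
  consider (V) v where "x = Vertex v" "v \<in> verts G"
    | (E) e where "x = Edge e" "e \<in> arcs G" | (G) e where "x = Ghost e" "e \<in> arcs G"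
    using assms by (auto simp: lpa_gens_def)
  then have "\<exists>s\<in>verts G. gen (Vertex s) * gen x - gen x \<in> (IG :: ('a, 'b, 'k::field) lpa_free set)"
  proof cases
    case V
    then show ?thesis
      using ideal_relator[OF lpa_relators.vertex_vertex[of v G v]] by auto
  next
    case E
    then show ?thesis
      using ideal_relator[OF lpa_relators.tail_edge[of e G]] by auto
  next
    case G
    then show ?thesis
      using ideal_relator[OF lpa_relators.head_ghost[of e G]] by auto
  qed
  then obtain s where s: "s \<in> verts G" "gen (Vertex s) * gen x - gen x \<in> (IG :: ('a, 'b, 'k::field) lpa_free set)" by blast
  have "vsum * gen x - gen x
      = - ((vsum :: ('a, 'b, 'k) lpa_free) * (gen (Vertex s) * gen x - gen x))
        + ((vsum * gen (Vertex s) - gen (Vertex s)) * gen x + (gen (Vertex s) * gen x - gen x))"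
    by (simp add: algebra_simps)
  also have "\<dots> \<in> IG"
    using s(2) ideal_mult_left[OF vsum_free s(2)]
      ideal_mult_right[OF free_algebra_gen[OF assms] vsum_vertex(1)[OF s(1)]]
    by (intro ideal_add ideal_uminus)
  finally show "vsum * gen x - gen x \<in> (IG :: ('a, 'b, 'k::field) lpa_free set)" .
  consider (V) v where "x = Vertex v" "v \<in> verts G"
    | (E) e where "x = Edge e" "e \<in> arcs G" | (G) e where "x = Ghost e" "e \<in> arcs G"
    using assms by (auto simp: lpa_gens_def)
  then have "\<exists>s\<in>verts G. gen x * gen (Vertex s) - gen x \<in> (IG :: ('a, 'b, 'k::field) lpa_free set)"
  proof cases
    case V
    then show ?thesis
      using ideal_relator[OF lpa_relators.vertex_vertex[of v G v]] by auto
  next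
    case E
    then show ?thesis
      using ideal_relator[OF lpa_relators.edge_head[of e G]] by auto
  next
    case G
    then show ?thesis
      using ideal_relator[OF lpa_relators.ghost_tail[of e G]] by auto
  qed
  then obtain r where r: "r \<in> verts G" "gen x * gen (Vertex r) - gen x \<in> (IG :: ('a, 'b, 'k::field) lpa_free set)" by blast
  have "gen x * vsum - gen x
      = - ((gen x * gen (Vertex r) - gen x) * (vsum :: ('a, 'b, 'k) lpa_free))
        + (gen x * (gen (Vertex r) * vsum - gen (Vertex r)) + (gen x * gen (Vertex r) - gen x))"
    by (simp add: algebra_simps)
  also have "\<dots> \<in> IG"
    using r(2) ideal_mult_right[OF vsum_free r(2)]
      ideal_mult_left[OF free_algebra_gen[OF assms] vsum_vertex(2)[OF r(1)]]
    by (intro ideal_add ideal_uminus)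
  finally show "gen x * vsum - gen x \<in> (IG :: ('a, 'b, 'k::field) lpa_free set)" .
qed

lemma vsum_single:
  fixes c :: "'k::field"
  assumes w: "letters w \<noteq> []" "set (letters w) \<subseteq> lpa_gens G"
  shows "vsum * Poly_Mapping.single w c - Poly_Mapping.single w c \<in> IG" (is ?l)
    and "Poly_Mapping.single w c * vsum - Poly_Mapping.single w c \<in> IG" (is ?r)
proof -
  show ?l
  proof (cases "tl (letters w) = []")
    case True
    then obtain x where x: "w = Word [x]" "x \<in> lpa_gens G"
      using w by (cases w; cases "letters w") auto
    have sc: "Poly_Mapping.single w c = Poly_Mapping.single 0 c * gen x"
      "Poly_Mapping.single w c = gen x * Poly_Mapping.single 0 c"
      by (simp_all add: x gen_def mult_single)
    have "vsum * Poly_Mapping.single w c - Poly_Mapping.single w c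
        = (vsum * gen x - gen x) * Poly_Mapping.single 0 c"
      unfolding sc(2) by (simp add: algebra_simps)
    moreover have "p * Poly_Mapping.single 0 c = Poly_Mapping.single 0 c * p"
      for p :: "('a, 'b, 'k) lpa_free"
      by (subst (1 2) poly_mapping_sum_single[of p])
        (simp add: sum_distrib_left sum_distrib_right mult_single mult.commute)
    ultimately show ?thesis using ideal_scale[OF vsum_gen(1)[OF x(2)]] by simp
  next
    case False
    then obtain x u where x: "w = Word (x # u)" "u \<noteq> []" "x \<in> lpa_gens G" "set u \<subseteq> lpa_gens G"
      using w by (cases w; cases "letters w") auto
    have sc: "Poly_Mapping.single w c = gen x * Poly_Mapping.single (Word u) c"
      by (simp add: x gen_def mult_single plus_fword_def)
    have "vsum * Poly_Mapping.single w c - Poly_Mapping.single w c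
        = (vsum * gen x - gen x) * Poly_Mapping.single (Word u) c"
      unfolding sc by (simp add: algebra_simps)
    then show ?thesis
      using ideal_mult_right[OF free_algebra_single vsum_gen(1)[OF x(3)], of "Word u" c] x
      by simp
  qed
  show ?r
  proof (cases "butlast (letters w) = []")
    case True
    then obtain x where x: "w = Word [x]" "x \<in> lpa_gens G"
      using w by (cases w; cases "letters w" rule: rev_cases) auto
    have sc: "Poly_Mapping.single w c = Poly_Mapping.single 0 c * gen x"
      by (simp add: x gen_def mult_single)
    have "Poly_Mapping.single w c * vsum - Poly_Mapping.single w c
        = Poly_Mapping.single 0 c * (gen x * vsum - gen x)"
      unfolding sc by (simp add: algebra_simps)
    then show ?thesis using ideal_scale[OF vsum_gen(2)[OF x(2)]] by simp
  next
    case False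
    then obtain x u where x: "w = Word (u @ [x])" "u \<noteq> []" "x \<in> lpa_gens G" "set u \<subseteq> lpa_gens G"
      using w by (cases w; cases "letters w" rule: rev_cases) auto
    have sc: "Poly_Mapping.single w c = Poly_Mapping.single (Word u) c * gen x"
      by (simp add: x gen_def mult_single plus_fword_def)
    have "Poly_Mapping.single w c * vsum - Poly_Mapping.single w c
        = Poly_Mapping.single (Word u) c * (gen x * vsum - gen x)"
      unfolding sc by (simp add: algebra_simps)
    then show ?thesis
      using ideal_mult_left[OF free_algebra_single vsum_gen(2)[OF x(3)], of "Word u" c] x
      by simp
  qed
qed

lemma vsum_unit:
  assumes "p \<in> FG"
  shows "vsum * p - p \<in> IG" and "p * vsum - p \<in> IG"
proof -
  let ?s = "\<lambda>w. Poly_Mapping.single w (Poly_Mapping.lookup p w)"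
  have p: "p = (\<Sum>w\<in>Poly_Mapping.keys p. ?s w)" by (rule poly_mapping_sum_single)
  have "vsum * p - p = (\<Sum>w\<in>Poly_Mapping.keys p. vsum * ?s w - ?s w)"
    by (subst (1 2) p) (simp only: sum_subtractf sum_distrib_left)
  also have "\<dots> \<in> IG"
    using assms by (auto intro!: ideal_sum vsum_single simp: free_algebra_def)
  finally show "vsum * p - p \<in> IG" .
  have "p * vsum - p = (\<Sum>w\<in>Poly_Mapping.keys p. ?s w * vsum - ?s w)"
    by (subst (1 2) p) (simp only: sum_subtractf sum_distrib_right)
  also have "\<dots> \<in> IG"
    using assms by (auto intro!: ideal_sum vsum_single simp: free_algebra_def)
  finally show "p * vsum - p \<in> IG" .
qed

lemma ring_leavitt_path_algebra: "ring (leavitt_path_algebra TYPE('k::field) G)"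
  (is "ring ?R")
proof (rule ringI)
  show "abelian_group ?R"
  proof (rule abelian_groupI)
    fix X assume "X \<in> carrier ?R"
    then obtain p where p: "p \<in> FG" "X = lpa_class G p" by (auto simp: lpa_carrier)
    then show "\<exists>Y\<in>carrier ?R. Y \<oplus>\<^bsub>?R\<^esub> X = \<zero>\<^bsub>?R\<^esub>"
      by (intro bexI[of _ "lpa_class G (- p)"])
        (simp_all add: lpa_class_add lpa_carrier lpa_zero free_algebra_uminus)
  qed (auto simp: lpa_carrier lpa_zero lpa_class_add free_algebra_zero free_algebra_add algebra_simps)
  show "monoid ?R"
  proof
    fix X assume "X \<in> carrier ?R"
    then obtain p where p: "p \<in> FG" "X = lpa_class G p" by (auto simp: lpa_carrier)
    show "\<one>\<^bsub>?R\<^esub> \<otimes>\<^bsub>?R\<^esub> X = X"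
      using p by (simp add: lpa_one lpa_class_mult vsum_free lpa_class_eq_iff free_algebra_mult vsum_unit)
    show "X \<otimes>\<^bsub>?R\<^esub> \<one>\<^bsub>?R\<^esub> = X"
      using p by (simp add: lpa_one lpa_class_mult vsum_free lpa_class_eq_iff free_algebra_mult vsum_unit)
  qed (auto simp: lpa_carrier lpa_one vsum_free lpa_class_mult free_algebra_mult mult.assoc)
qed (auto simp: lpa_carrier lpa_class_add lpa_class_mult free_algebra_mult free_algebra_add algebra_simps)

lemma homog_part_relator:
  assumes "p \<in> lpa_relators G"
  shows "homog_part n p \<in> IG"
proof -
  have "\<exists>d. homog_part n p = (if n = d then p else 0)"
    using assms
  proof cases
    case (regular v)
    show ?thesis
      by (rule exI[of _ 0]) (auto simp: regular homog_part_diff homog_part_sum)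
  qed (auto simp: homog_part_diff)
  then show ?thesis using assms by (auto intro: ideal_relator ideal_zero)
qed

lemma homog_part_ideal:
  fixes p :: "('a, 'b, 'k::field) lpa_free"
  assumes "p \<in> IG"
  shows "homog_part n p \<in> IG"
proof -
  let ?J = "{p \<in> FG. \<forall>n. homog_part n p \<in> IG} :: ('a, 'b, 'k) lpa_free set"
  have *: "a * p \<in> ?J \<and> p * a \<in> ?J" if a: "a \<in> FG" and p: "p \<in> ?J" for a p :: "('a, 'b, 'k) lpa_free"
  proof -
    let ?s = "\<lambda>w. Poly_Mapping.single w (Poly_Mapping.lookup a w)"
    have e: "a = (\<Sum>w\<in>Poly_Mapping.keys a. ?s w)" by (rule poly_mapping_sum_single)
    have s: "?s w \<in> FG" if "w \<in> Poly_Mapping.keys a" for w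
      using a that by (auto simp: free_algebra_def)
    have "homog_part n (a * p) \<in> IG" for n
      by (subst e) (use p s in \<open>auto simp: sum_distrib_right homog_part_sum homog_part_single_mult
        intro!: ideal_sum ideal_mult_left\<close>)
    moreover have "homog_part n (p * a) \<in> IG" for n
      by (subst e) (use p s in \<open>auto simp: sum_distrib_left homog_part_sum homog_part_mult_single
        intro!: ideal_sum ideal_mult_right\<close>)
    ultimately show ?thesis using a p by (auto intro: free_algebra_mult)
  qed
  have "algebra_ideal FG ?J"
    unfolding algebra_ideal_def
  proof (intro conjI ballI allI)
    fix c and p :: "('a, 'b, 'k) lpa_free" assume "p \<in> ?J"
    then show "Poly_Mapping.single 0 c * p \<in> ?J"
      by (auto simp: homog_part_single_mult intro: free_algebra_intros ideal_scale)
  qed (use * in \<open>auto simp: ideal_zero homog_part_add intro: free_algebra_intros ideal_add\<close>)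
  moreover have "lpa_relators G \<subseteq> ?J"
    using lpa_relators_subset homog_part_relator by auto
  ultimately have "IG \<subseteq> ?J" unfolding lpa_ideal_def by (metis (no_types, lifting) hull_minimal)
  then show ?thesis using assms by blast
qed

lemma finsum_lpa_class:
  assumes "finite S" "\<And>i. i \<in> S \<Longrightarrow> f i \<in> FG"
  shows "finsum (leavitt_path_algebra TYPE('k::field) G) (\<lambda>i. lpa_class G (f i)) S
    = lpa_class G (\<Sum>i\<in>S. f i)"
proof -
  interpret ring "leavitt_path_algebra TYPE('k) G" by (rule ring_leavitt_path_algebra)
  show ?thesis
    using assms
    by (induction S rule: finite_induct)
      (auto simp: lpa_zero lpa_carrier Pi_def lpa_class_add free_algebra_sum)
qed

theorem graded_ring_leavitt_path_algebra:
  "graded_ring (leavitt_path_algebra TYPE('k::field) G) (lpa_component TYPE('k) G)"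
  (is "graded_ring ?R ?A")
proof -
  let ?H = "\<lambda>n. {p \<in> FG. \<forall>w\<in>Poly_Mapping.keys p. word_deg w = n} :: ('a, 'b, 'k) lpa_free set"
  interpret R: ring ?R by (rule ring_leavitt_path_algebra)
  have A: "?A n = lpa_class G ` ?H n" for n by (simp add: lpa_component_def)
  have sub: "?A n \<subseteq> carrier ?R" for n by (auto simp: A lpa_carrier)
  show ?thesis
  proof (intro graded_ring.intro graded_ring_axioms.intro ring_leavitt_path_algebra)
    fix m n
    show "additive_subgroup (?A n) ?R"
    proof
      show "?A n \<subseteq> carrier (add_monoid ?R)" using sub by simp
      show "X \<otimes>\<^bsub>add_monoid ?R\<^esub> Y \<in> ?A n" if XY: "X \<in> ?A n" "Y \<in> ?A n" for X Y
      proof -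
        obtain p q where pq: "p \<in> ?H n" "X = lpa_class G p" "q \<in> ?H n" "Y = lpa_class G q"
          using XY unfolding A by blast
        have "p + q \<in> ?H n"
          using pq keys_add[of p q] by (auto intro: free_algebra_add)
        then show ?thesis using pq by (simp add: lpa_class_add A)
      qed
      have "0 \<in> ?H n" by (simp add: free_algebra_zero)
      then show "\<one>\<^bsub>add_monoid ?R\<^esub> \<in> ?A n" by (simp only: A) (simp add: lpa_zero)
      show "inv\<^bsub>add_monoid ?R\<^esub> X \<in> ?A n" if X: "X \<in> ?A n" for X
      proof -
        obtain p where p: "p \<in> ?H n" "X = lpa_class G p" using X unfolding A by blast
        have m: "- p \<in> ?H n" using p by (auto simp: in_keys_iff intro: free_algebra_uminus)
        then have "lpa_class G (- p) \<oplus>\<^bsub>?R\<^esub> X = \<zero>\<^bsub>?R\<^esub>"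
          using p by (simp add: lpa_class_add lpa_zero)
        then have "\<ominus>\<^bsub>?R\<^esub> X = lpa_class G (- p)"
          using p m by (intro R.minus_equality) (auto simp: lpa_carrier)
        then show ?thesis using m by (simp add: A a_inv_def)
      qed
    qed
    fix X Y assume "X \<in> ?A m" "Y \<in> ?A n"
    then obtain p q where pq: "p \<in> ?H m" "X = lpa_class G p" "q \<in> ?H n" "Y = lpa_class G q"
      unfolding A by blast
    have "p * q \<in> ?H (m + n)"
      using pq keys_mult[of p q] by (fastforce simp: word_deg_plus intro: free_algebra_mult)
    then show "X \<otimes>\<^bsub>?R\<^esub> Y \<in> ?A (m + n)" using pq by (simp add: lpa_class_mult A)
  next
    fix X assume "X \<in> carrier ?R"
    then obtain p where p: "p \<in> FG" "X = lpa_class G p" by (auto simp: lpa_carrier)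
    define c where "c n = lpa_class G (homog_part n p)" for n
    have hF: "homog_part n p \<in> FG" for n using p by (simp add: homog_part_free_algebra)
    have extend: "finsum ?R d {n. d n \<noteq> \<zero>\<^bsub>?R\<^esub>} = finsum ?R d S"
      if "finite S" "{n. d n \<noteq> \<zero>\<^bsub>?R\<^esub>} \<subseteq> S" "\<And>n. d n \<in> ?A n" for d and S :: "int set"
    proof -
      have "d i \<in> carrier ?R" for i using sub[of i] that(3)[of i] by (rule subsetD)
      then show ?thesis
        using that(1,2) by (intro R.add.finprod_mono_neutral_cong_left) auto
    qed
    show "\<exists>!c. (\<forall>n. c n \<in> ?A n) \<and> finite {n. c n \<noteq> \<zero>\<^bsub>?R\<^esub>} \<and>
        X = finsum ?R c {n. c n \<noteq> \<zero>\<^bsub>?R\<^esub>}"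
    proof (rule ex1I[of _ c], intro conjI allI)
      have "homog_part n p \<in> ?H n" for n using hF[of n] by (auto simp: keys_homog_part)
      then show cA: "c n \<in> ?A n" for n unfolding c_def A by blast
      let ?S = "word_deg ` Poly_Mapping.keys p"
      have cS: "{n. c n \<noteq> \<zero>\<^bsub>?R\<^esub>} \<subseteq> ?S"
      proof
        fix n assume "n \<in> {n. c n \<noteq> \<zero>\<^bsub>?R\<^esub>}"
        then have "homog_part n p \<noteq> 0" by (auto simp: c_def lpa_zero)
        then have "Poly_Mapping.keys (homog_part n p) \<noteq> {}" by simp
        then show "n \<in> ?S" by (auto simp: keys_homog_part)
      qed
      then show "finite {n. c n \<noteq> \<zero>\<^bsub>?R\<^esub>}" by (rule finite_subset) simp
      have "finsum ?R c {n. c n \<noteq> \<zero>\<^bsub>?R\<^esub>} = finsum ?R c ?S"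
        using cA cS by (intro extend) auto
      also have "\<dots> = lpa_class G (\<Sum>n\<in>?S. homog_part n p)"
        unfolding c_def by (rule finsum_lpa_class) (auto intro: hF)
      also have "(\<Sum>n\<in>?S. homog_part n p) = p"
        by (rule homog_part_decomp[symmetric]) auto
      finally show "X = finsum ?R c {n. c n \<noteq> \<zero>\<^bsub>?R\<^esub>}" using p by simp
    next
      fix d assume d: "(\<forall>n. d n \<in> ?A n) \<and> finite {n. d n \<noteq> \<zero>\<^bsub>?R\<^esub>} \<and>
        X = finsum ?R d {n. d n \<noteq> \<zero>\<^bsub>?R\<^esub>}"
      have "\<forall>n. \<exists>q. q \<in> ?H n \<and> d n = lpa_class G q" using d unfolding A by blast
      then obtain q where "\<forall>n. q n \<in> ?H n \<and> d n = lpa_class G (q n)"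
        by (rule choice[THEN exE])
      then have q: "\<And>n. q n \<in> ?H n" "\<And>n. d n = lpa_class G (q n)" by blast+
      show "d = c"
      proof
        fix n
        let ?T = "insert n {n. d n \<noteq> \<zero>\<^bsub>?R\<^esub>}"
        have T: "finite ?T" using d by simp
        have "lpa_class G p = finsum ?R d ?T"
          using d p T extend[of ?T d] by auto
        also have "\<dots> = finsum ?R (\<lambda>n. lpa_class G (q n)) ?T"
          by (simp add: q(2)[symmetric])
        also have "\<dots> = lpa_class G (\<Sum>i\<in>?T. q i)"
          using q(1) by (intro finsum_lpa_class[OF T]) auto
        finally have "(\<Sum>i\<in>?T. q i) - p \<in> IG"
          using p q(1) by (subst (asm) lpa_class_eq_iff) (auto intro: free_algebra_sum ideal_sym)
        then have "homog_part n ((\<Sum>i\<in>?T. q i) - p) \<in> IG" by (rule homog_part_ideal)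
        moreover have "homog_part n (\<Sum>i\<in>?T. q i) = q n"
        proof -
          have "homog_part n (\<Sum>i\<in>?T. q i) = (\<Sum>i\<in>?T. if n = i then q i else 0)"
            unfolding homog_part_sum
            using q(1) by (intro sum.cong refl homog_part_same) auto
          also have "\<dots> = q n" using T by (subst sum.delta') auto
          finally show ?thesis .
        qed
        ultimately have "q n - homog_part n p \<in> IG" by (simp add: homog_part_diff)
        then show "d n = c n"
          unfolding q(2) c_def using q(1)[of n] hF by (subst lpa_class_eq_iff) auto
      qed
    qed
  qed
qed

end

end

theory Submission
  imports Defs "HOL-Library.Function_Algebras"
begin

text \<open>A unital ring homomorphism from \<open>R\<close> to the square matrices of some positive size over a field forces
  invariant basis number on \<open>R\<close>, since it turns an invertible \<open>n \<times> m\<close> matrix over \<open>R\<close> into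
  an invertible block matrix over the field, whose shape must be square. It also forces the graded
  version, because a graded isomorphism is an isomorphism of modules. So the task is to find a nonzero
  finite-dimensional representation of the Leavitt path algebra.

  Such a representation amounts to finite-dimensional spaces \<open>V\<^sub>v\<close> for the vertices \<open>v\<close>, together
  with isomorphisms of \<open>V\<^sub>v\<close> with the direct sum of the spaces \<open>V\<^bsub>r(e)\<^esub>\<close> over the edges \<open>e\<close>
  leaving \<open>v\<close>, for each regular \<open>v\<close>. Only the dimensions matter: what is needed is a nonzero function
  \<open>d\<close> from vertices to natural numbers with \<open>d v = (\<Sum>e\<in>out_arcs G v. d (head G e))\<close> at every
  regular \<open>v\<close>. Lemma \<open>ex_branching_system\<close> realises \<open>d\<close> by a set with partial injections, and the locale
  \<open>branching_system\<close> turns these into matrices that satisfy the defining relations.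

  The dimension function comes from the graph. If there is no cycle, some vertex \<open>w\<close> is a sink, and
  \<open>d v\<close> counts the walks from \<open>v\<close> to \<open>w\<close>. If there are cycles, let \<open>w\<close> lie on one that no other
  cycle leads to; it exists because distinct cycles have no common vertex, so that each strongly
  connected component contains at most one of them. Now \<open>d v\<close> counts the walks from \<open>v\<close> that end
  at their first visit to \<open>w\<close>. There are finitely many, as such a walk has no cycle to run around, and the
  equation at \<open>w\<close> holds because its own cycle is the only way back to it. This is
  \<open>ex_dimension_function\<close>; the hypothesis on cycles enters only through \<open>unique_recurrent_arc\<close>.\<close>

section \<open>Invariant basis number from matrix representations\<close>

text \<open>The hypothesis says that \<open>A\<close> is a left inverse of \<open>B\<close>, so the columns of \<open>B\<close> are linearly
  independent vectors indexed by \<open>I\<close>. They live in a space of dimension \<open>card J\<close>.\<close>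
lemma card_le_if_right_invertible:
  fixes A :: "'i \<Rightarrow> 'j \<Rightarrow> 'k::field" and B :: "'j \<Rightarrow> 'i \<Rightarrow> 'k"
  assumes "finite I" "finite J"
    and AB: "\<And>i i'. i \<in> I \<Longrightarrow> i' \<in> I \<Longrightarrow> (\<Sum>j\<in>J. A i j * B j i') = (if i = i' then 1 else 0)"
  shows "card I \<le> card J"
proof -
  interpret vector_space "\<lambda>(c::'k) (v::'j \<Rightarrow> 'k) j. c * v j"
    by unfold_locales (auto simp: fun_eq_iff algebra_simps)
  \<comment> \<open>The columns of \<open>B\<close>, cut off outside \<open>J\<close> so that finitely many unit vectors span them.\<close>
  define b where "b i j = (if j \<in> J then B j i else 0)" for i j
  define unit where "unit j l = (if l = j then 1 else 0 :: 'k)" for j l :: 'j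
  have sum_app: "(\<Sum>i\<in>S. g i) l = (\<Sum>i\<in>S. g i l)" for S and g :: "'s \<Rightarrow> 'j \<Rightarrow> 'k" and l
    by (induction S rule: infinite_finite_induct) auto
  have Ab: "(\<Sum>j\<in>J. A i j * b i' j) = (if i = i' then 1 else 0)" if "i \<in> I" "i' \<in> I" for i i'
    using AB[OF that] by (simp add: b_def)
  have inj: "inj_on b I"
  proof (rule inj_onI)
    fix i i' assume i: "i \<in> I" "i' \<in> I" "b i = b i'"
    then show "i = i'" using Ab[of i i] Ab[of i i'] by (auto split: if_splits)
  qed
  have "independent (b ` I)"
  proof (rule independent_if_scalars_zero)
    fix f x assume s: "(\<Sum>x\<in>b ` I. (\<lambda>j. f x * x j)) = 0" and "x \<in> b ` I"
    then obtain i where i: "i \<in> I" "x = b i" by blast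
    have "0 = (\<Sum>j\<in>J. A i j * (\<Sum>x\<in>b ` I. (\<lambda>j. f x * x j)) j)"
      by (simp add: s)
    also have "\<dots> = (\<Sum>j\<in>J. \<Sum>i'\<in>I. f (b i') * (A i j * b i' j))"
      using inj by (simp add: sum_app sum.reindex sum_distrib_left mult_ac)
    also have "\<dots> = (\<Sum>i'\<in>I. f (b i') * (\<Sum>j\<in>J. A i j * b i' j))"
      by (subst sum.swap) (simp add: sum_distrib_left)
    also have "\<dots> = (\<Sum>i'\<in>I. f (b i') * (if i = i' then 1 else 0))"
      using i by (intro sum.cong refl) (simp add: Ab)
    also have "\<dots> = f x" using i \<open>finite I\<close> by (simp add: if_distrib cong: if_cong)
    finally show "f x = 0" by simp
  qed (use assms in simp)
  moreover have "b ` I \<subseteq> span (unit ` J)"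
  proof
    fix x assume "x \<in> b ` I"
    then obtain i where i: "x = b i" by blast
    have "x = (\<Sum>j\<in>J. (\<lambda>l. B j i * unit j l))"
      using \<open>finite J\<close>
      by (auto simp: i fun_eq_iff sum_app b_def unit_def if_distrib cong: if_cong)
    also have "\<dots> \<in> span (unit ` J)"
      by (intro span_sum span_scale span_base) auto
    finally show "x \<in> span (unit ` J)" .
  qed
  ultimately have "card (b ` I) \<le> card (unit ` J)"
    using independent_span_bound[of "unit ` J" "b ` I"] assms by simp
  also have "\<dots> \<le> card J" using assms(2) by (rule card_image_le)
  finally show ?thesis using inj by (simp add: card_image)
qed

text \<open>A unital ring homomorphism \<open>h\<close> from \<open>R\<close> to the matrices over a field whose rows and columns are
  indexed by a finite nonempty set \<open>X\<close>. Indexing by an arbitrary set instead of an initial segment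
  of \<open>nat\<close> lets block matrices be indexed by a product with \<open>X\<close>.\<close>
locale matrix_representation = ring R for R (structure) +
  fixes X :: "'x set" and h :: "'a \<Rightarrow> 'x \<Rightarrow> 'x \<Rightarrow> 'k::field"
  assumes finite_index: "finite X" and index_nonempty: "X \<noteq> {}"
    and h_add: "\<lbrakk>a \<in> carrier R; b \<in> carrier R; x \<in> X; y \<in> X\<rbrakk> \<Longrightarrow>
      h (a \<oplus> b) x y = h a x y + h b x y"
    and h_mult: "\<lbrakk>a \<in> carrier R; b \<in> carrier R; x \<in> X; z \<in> X\<rbrakk> \<Longrightarrow>
      h (a \<otimes> b) x z = (\<Sum>y\<in>X. h a x y * h b y z)"
    and h_one: "\<lbrakk>x \<in> X; y \<in> X\<rbrakk> \<Longrightarrow> h \<one> x y = (if x = y then 1 else 0)"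
begin

abbreviation free_module :: "('g \<Rightarrow> 'a set) \<Rightarrow> nat \<Rightarrow> (nat \<Rightarrow> 'g::ab_group_add)
    \<Rightarrow> ('a, 'g, nat \<Rightarrow> 'a) gr_right_module" where
  "free_module A n \<alpha> \<equiv> gr_direct_sum n (\<lambda>i. gr_shift (\<alpha> i) (regular_gr_module R A))"

lemma free_module_simps:
  "carrier (free_module A n \<alpha>) = ({..<n} \<rightarrow>\<^sub>E carrier R)"
  "x \<oplus>\<^bsub>free_module A n \<alpha>\<^esub> y = (\<lambda>i\<in>{..<n}. x i \<oplus> y i)"
  "ract (free_module A n \<alpha>) x r = (\<lambda>i\<in>{..<n}. x i \<otimes> r)"
  by (simp_all add: gr_direct_sum_def gr_shift_def regular_gr_module_def)

lemma h_zero: "x \<in> X \<Longrightarrow> y \<in> X \<Longrightarrow> h \<zero> x y = 0"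
  using h_add[of \<zero> \<zero> x y] by (metis add_cancel_right_right l_zero zero_closed)

definition basis_vec :: "nat \<Rightarrow> nat \<Rightarrow> nat \<Rightarrow> 'a" where
  "basis_vec n j = (\<lambda>i\<in>{..<n}. if i = j then \<one> else \<zero>)"

text \<open>A module homomorphism between free modules is multiplication by the matrix of the images of the
  basis vectors; this is what becomes of that fact after applying \<open>h\<close>. The induction adds the
  coordinates of \<open>u\<close> one at a time. Reading off the identity after applying \<open>h\<close> keeps all sums in the
  field.\<close>
lemma free_module_map_matrix:
  fixes m n :: nat
  assumes f: "f \<in> ({..<m} \<rightarrow>\<^sub>E carrier R) \<rightarrow> ({..<n} \<rightarrow>\<^sub>E carrier R)"
    and f_add: "\<And>u v. \<lbrakk>u \<in> {..<m} \<rightarrow>\<^sub>E carrier R; v \<in> {..<m} \<rightarrow>\<^sub>E carrier R\<rbrakk> \<Longrightarrow>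
      f (\<lambda>i\<in>{..<m}. u i \<oplus> v i) = (\<lambda>i\<in>{..<n}. f u i \<oplus> f v i)"
    and f_act: "\<And>u r. \<lbrakk>u \<in> {..<m} \<rightarrow>\<^sub>E carrier R; r \<in> carrier R\<rbrakk> \<Longrightarrow>
      f (\<lambda>i\<in>{..<m}. u i \<otimes> r) = (\<lambda>i\<in>{..<n}. f u i \<otimes> r)"
    and u: "u \<in> {..<m} \<rightarrow>\<^sub>E carrier R" and k: "k < n" and x: "x \<in> X" and z: "z \<in> X"
  shows "h (f u k) x z = (\<Sum>j<m. \<Sum>y\<in>X. h (f (basis_vec m j) k) x y * h (u j) y z)"
proof -
  \<comment> \<open>\<open>t l\<close> keeps the first \<open>l\<close> coordinates of \<open>u\<close>.\<close>
  define t where "t l = (\<lambda>i\<in>{..<m}. if i < l then u i else \<zero>)" for l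
  have t: "t l \<in> {..<m} \<rightarrow>\<^sub>E carrier R" for l
    unfolding t_def using PiE_mem[OF u] by (intro restrict_PiE_iff[THEN iffD2] ballI) auto
  have b: "basis_vec m l \<in> {..<m} \<rightarrow>\<^sub>E carrier R" for l
    unfolding basis_vec_def by (intro restrict_PiE_iff[THEN iffD2] ballI) auto
  have f_in: "f v k \<in> carrier R" if "v \<in> {..<m} \<rightarrow>\<^sub>E carrier R" for v
    using PiE_mem[OF funcset_mem[OF f that]] k by simp
  have "h (f (t l) k) x z = (\<Sum>j<l. \<Sum>y\<in>X. h (f (basis_vec m j) k) x y * h (u j) y z)"
    if "l \<le> m" for l
    using that
  proof (induction l)
    case 0
    have t0: "(\<lambda>i\<in>{..<m}. t 0 i \<oplus> t 0 i) = t 0" by (auto simp: t_def)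
    have "f (t 0) k = f (\<lambda>i\<in>{..<m}. t 0 i \<oplus> t 0 i) k" by (subst t0) (rule refl)
    also have "\<dots> = f (t 0) k \<oplus> f (t 0) k" using k by (subst f_add[OF t t]) simp
    finally have dbl: "f (t 0) k = f (t 0) k \<oplus> f (t 0) k" .
    then have "h (f (t 0) k) x z = h (f (t 0) k) x z + h (f (t 0) k) x z"
      by (subst (1) dbl) (rule h_add[OF f_in[OF t] f_in[OF t] x z])
    then have "h (f (t 0) k) x z = 0" unfolding add_cancel_right_right .
    then show ?case by simp
  next
    case (Suc l)
    have ul: "u l \<in> carrier R" using PiE_mem[OF u] Suc.prems by simp
    define s where "s = (\<lambda>i\<in>{..<m}. basis_vec m l i \<otimes> u l)"
    have s: "s \<in> {..<m} \<rightarrow>\<^sub>E carrier R" 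
      unfolding s_def using ul PiE_mem[OF b] by (intro restrict_PiE_iff[THEN iffD2] ballI) auto
    have "t (Suc l) = (\<lambda>i\<in>{..<m}. t l i \<oplus> s i)"
      using PiE_mem[OF u] ul by (auto simp: t_def s_def basis_vec_def fun_eq_iff less_Suc_eq)
    then have "f (t (Suc l)) = (\<lambda>i\<in>{..<n}. f (t l) i \<oplus> f s i)"
      by (simp only: f_add[OF t s])
    moreover have "f s = (\<lambda>i\<in>{..<n}. f (basis_vec m l) i \<otimes> u l)"
      unfolding s_def by (rule f_act[OF b ul])
    ultimately have "f (t (Suc l)) k = f (t l) k \<oplus> f (basis_vec m l) k \<otimes> u l"
      using k by simp
    then show ?case
      using Suc ul by (simp add: h_add h_mult x z f_in t b)
  qed
  from this[of m] have "h (f (t m) k) x z = (\<Sum>j<m. \<Sum>y\<in>X. h (f (basis_vec m j) k) x y * h (u j) y z)"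
    by simp
  moreover have "t m = restrict u {..<m}" unfolding t_def by (rule restrict_ext) simp
  then have "t m = u" by (simp only: PiE_restrict[OF u])
  ultimately show ?thesis by simp
qed

text \<open>Preimages of the basis vectors form a right inverse of the matrix of \<open>f\<close>. Under \<open>h\<close> this becomes
  a right-invertible block matrix over the field, with \<open>n\<close> block rows and \<open>m\<close> block columns.\<close>
lemma rank_le_of_surjective:
  fixes m n :: nat
  assumes f: "f ` ({..<m} \<rightarrow>\<^sub>E carrier R) = ({..<n} \<rightarrow>\<^sub>E carrier R)"
    and f_add: "\<And>u v. \<lbrakk>u \<in> {..<m} \<rightarrow>\<^sub>E carrier R; v \<in> {..<m} \<rightarrow>\<^sub>E carrier R\<rbrakk> \<Longrightarrow>
      f (\<lambda>i\<in>{..<m}. u i \<oplus> v i) = (\<lambda>i\<in>{..<n}. f u i \<oplus> f v i)"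
    and f_act: "\<And>u r. \<lbrakk>u \<in> {..<m} \<rightarrow>\<^sub>E carrier R; r \<in> carrier R\<rbrakk> \<Longrightarrow>
      f (\<lambda>i\<in>{..<m}. u i \<otimes> r) = (\<lambda>i\<in>{..<n}. f u i \<otimes> r)"
  shows "n \<le> m"
proof -
  have "\<exists>u\<in>{..<m} \<rightarrow>\<^sub>E carrier R. f u = basis_vec n i" for i
  proof -
    have "basis_vec n i \<in> f ` ({..<m} \<rightarrow>\<^sub>E carrier R)" unfolding f basis_vec_def by (intro restrict_PiE_iff[THEN iffD2] ballI) auto
    then show ?thesis by force
  qed
  then obtain g where g: "\<And>i. g i \<in> {..<m} \<rightarrow>\<^sub>E carrier R" "\<And>i. f (g i) = basis_vec n i"
    by metis
  have f_fun: "f \<in> ({..<m} \<rightarrow>\<^sub>E carrier R) \<rightarrow> ({..<n} \<rightarrow>\<^sub>E carrier R)"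
    using f by blast
  have "card ({..<n} \<times> X) \<le> card ({..<m} \<times> X)"
  proof (rule card_le_if_right_invertible)
    fix p q assume "p \<in> {..<n} \<times> X" "q \<in> {..<n} \<times> X"
    then obtain k x i z where pq: "p = (k, x)" "q = (i, z)" "k < n" "i < n" "x \<in> X" "z \<in> X"
      by auto
    have "(\<Sum>r\<in>{..<m} \<times> X. h (f (basis_vec m (fst r)) (fst p)) (snd p) (snd r)
            * h (g (fst q) (fst r)) (snd r) (snd q))
        = (\<Sum>j<m. \<Sum>y\<in>X. h (f (basis_vec m j) k) x y * h (g i j) y z)"
      by (simp add: pq sum.cartesian_product split_def)
    also have "\<dots> = h (f (g i) k) x z"
      by (rule free_module_map_matrix[OF f_fun f_add f_act g(1) pq(3,5,6), symmetric])
    also have "\<dots> = (if p = q then 1 else 0)"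
      using pq by (auto simp: g basis_vec_def h_one h_zero)
    finally show "(\<Sum>r\<in>{..<m} \<times> X. h (f (basis_vec m (fst r)) (fst p)) (snd p) (snd r)
            * h (g (fst q) (fst r)) (snd r) (snd q)) = (if p = q then 1 else 0)" .
  qed (use finite_index in auto)
  moreover have "card X > 0" using finite_index index_nonempty by (simp add: card_gt_0_iff)
  ultimately show ?thesis by (simp add: card_cartesian_product)
qed

text \<open>Invertible matrices over \<open>R\<close> stay invertible under \<open>h\<close>, so a ring with a finite-dimensional
  representation has invariant basis number. An isomorphism of graded modules is in particular an
  isomorphism of modules, and a shifted copy of \<open>R\<close> is \<open>R\<close> as a module.\<close>
theorem gr_IBN: "gr_IBN R (A :: 'g::ab_group_add \<Rightarrow> 'a set)"
  unfolding gr_IBN_def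
proof (intro allI impI)
  fix m n :: nat and \<alpha> \<beta> :: "nat \<Rightarrow> 'g"
  assume "gr_isomorphic R (free_module A m \<alpha>) (free_module A n \<beta>)"
  then obtain f where "gr_module_iso R (free_module A m \<alpha>) (free_module A n \<beta>) f"
    unfolding gr_isomorphic_def by blast
  then have f: "bij_betw f ({..<m} \<rightarrow>\<^sub>E carrier R) ({..<n} \<rightarrow>\<^sub>E carrier R)"
    and f_add: "\<And>u v. \<lbrakk>u \<in> {..<m} \<rightarrow>\<^sub>E carrier R; v \<in> {..<m} \<rightarrow>\<^sub>E carrier R\<rbrakk> \<Longrightarrow>
      f (\<lambda>i\<in>{..<m}. u i \<oplus> v i) = (\<lambda>i\<in>{..<n}. f u i \<oplus> f v i)"
    and f_act: "\<And>u r. \<lbrakk>u \<in> {..<m} \<rightarrow>\<^sub>E carrier R; r \<in> carrier R\<rbrakk> \<Longrightarrow>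
      f (\<lambda>i\<in>{..<m}. u i \<otimes> r) = (\<lambda>i\<in>{..<n}. f u i \<otimes> r)"
    by (simp_all add: gr_module_iso_def free_module_simps)
  define g where "g = inv_into ({..<m} \<rightarrow>\<^sub>E carrier R) f"
  have g: "bij_betw g ({..<n} \<rightarrow>\<^sub>E carrier R) ({..<m} \<rightarrow>\<^sub>E carrier R)"
    unfolding g_def by (rule bij_betw_inv_into[OF f])
  have g_in: "g v \<in> {..<m} \<rightarrow>\<^sub>E carrier R" if "v \<in> {..<n} \<rightarrow>\<^sub>E carrier R" for v
    using bij_betwE[OF g] that by blast
  have fg: "f (g v) = v" if "v \<in> {..<n} \<rightarrow>\<^sub>E carrier R" for v
    unfolding g_def using that f by (simp add: bij_betw_inv_into_right)
  have gf: "g (f u) = u" if "u \<in> {..<m} \<rightarrow>\<^sub>E carrier R" for u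
    unfolding g_def using that f by (simp add: bij_betw_inv_into_left)
  have "n \<le> m"
    using bij_betw_imp_surj_on[OF f] f_add f_act by (rule rank_le_of_surjective)
  moreover have "m \<le> n"
  proof (rule rank_le_of_surjective[of g])
    show "g ` ({..<n} \<rightarrow>\<^sub>E carrier R) = {..<m} \<rightarrow>\<^sub>E carrier R"
      by (rule bij_betw_imp_surj_on[OF g])
    fix u v assume uv: "u \<in> {..<n} \<rightarrow>\<^sub>E carrier R" "v \<in> {..<n} \<rightarrow>\<^sub>E carrier R"
    have "(\<lambda>i\<in>{..<m}. g u i \<oplus> g v i) \<in> {..<m} \<rightarrow>\<^sub>E carrier R"
      using PiE_mem[OF g_in[OF uv(1)]] PiE_mem[OF g_in[OF uv(2)]] by (intro restrict_PiE_iff[THEN iffD2] ballI) auto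
    from gf[OF this] show "g (\<lambda>i\<in>{..<n}. u i \<oplus> v i) = (\<lambda>i\<in>{..<m}. g u i \<oplus> g v i)"
      by (simp only: f_add[OF g_in[OF uv(1)] g_in[OF uv(2)]] fg uv)
  next
    fix u r assume ur: "u \<in> {..<n} \<rightarrow>\<^sub>E carrier R" "r \<in> carrier R"
    have "(\<lambda>i\<in>{..<m}. g u i \<otimes> r) \<in> {..<m} \<rightarrow>\<^sub>E carrier R"
      using PiE_mem[OF g_in[OF ur(1)]] ur(2) by (intro restrict_PiE_iff[THEN iffD2] ballI) auto
    from gf[OF this] show "g (\<lambda>i\<in>{..<n}. u i \<otimes> r) = (\<lambda>i\<in>{..<m}. g u i \<otimes> r)"
      by (simp only: f_act[OF g_in[OF ur(1)] ur(2)] fg ur)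
  qed
  ultimately show "m = n" by simp
qed

end

section \<open>Representations from branching systems\<close>

text \<open>A finite form of the algebraic branching systems of the theory of Leavitt path algebras: a set
  \<open>X\<close> fibred over the vertices by \<open>\<pi>\<close> such that, for every regular \<open>v\<close>, the edges leaving \<open>v\<close> cut
  the fibre over \<open>v\<close> into copies of the fibres over their heads. The algebra then acts on
  the vector space with basis \<open>X\<close>: vertices project onto fibres, an edge \<open>e\<close> applies \<open>\<phi> e\<close>, and the
  ghost edge applies the partial inverse of \<open>\<phi> e\<close>.\<close>
locale branching_system = fin_digraph G for G :: "('a, 'b) pre_digraph" (structure) +
  fixes X :: "'x set" and \<pi> :: "'x \<Rightarrow> 'a" and \<phi> :: "'b \<Rightarrow> 'x \<Rightarrow> 'x"
  assumes finite_points: "finite X" and points_nonempty: "X \<noteq> {}"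
    and base_in_verts: "x \<in> X \<Longrightarrow> \<pi> x \<in> verts G"
    and branching: "regular_vertex G v \<Longrightarrow>
      bij_betw (\<lambda>(e, x). \<phi> e x) (SIGMA e:out_arcs G v. {x \<in> X. \<pi> x = head G e}) {x \<in> X. \<pi> x = v}"
begin

lemma regular_tail: "e \<in> arcs G \<Longrightarrow> regular_vertex G (tail G e)"
  by (auto simp: regular_vertex_def out_arcs_def)

lemma branch_in:
  assumes "e \<in> arcs G" "x \<in> X" "\<pi> x = head G e"
  shows "\<phi> e x \<in> X" and "\<pi> (\<phi> e x) = tail G e"
  using bij_betw_apply[OF branching[OF regular_tail[OF assms(1)]], of "(e, x)"] assms by auto

lemma branch_inject:
  assumes "e \<in> arcs G" "x \<in> X" "\<pi> x = head G e" "f \<in> arcs G" "y \<in> X" "\<pi> y = head G f"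
    and "\<phi> e x = \<phi> f y"
  shows "e = f" and "x = y"
proof -
  have "tail G f = tail G e"
    using branch_in(2)[OF assms(1-3)] branch_in(2)[OF assms(4-6)] assms(7) by simp
  then have "(e, x) = (f, y)"
    using bij_betw_imp_inj_on[OF branching[OF regular_tail[OF assms(1)]]] assms
    by (intro inj_onD[where f = "\<lambda>(e, x). \<phi> e x"]) auto
  then show "e = f" "x = y" by simp_all
qed

lemma branch_exists:
  assumes "regular_vertex G (\<pi> x)" "x \<in> X"
  obtains e y where "e \<in> out_arcs G (\<pi> x)" "y \<in> X" "\<pi> y = head G e" "\<phi> e y = x"
  using bij_betw_imp_surj_on[OF branching[OF assms(1)]] assms(2) by (force simp: image_iff)

text \<open>The action on basis elements, where \<open>None\<close> stands for the zero vector. The tests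
  \<open>e \<in> arcs G\<close> keep the set \<open>X\<close> invariant under letters that are not generators of the algebra.\<close>
primrec gen_act :: "('a, 'b) lpa_gen \<Rightarrow> 'x \<Rightarrow> 'x option" where
  "gen_act (Vertex v) x = (if x \<in> X \<and> \<pi> x = v then Some x else None)"
| "gen_act (Edge e) x = (if e \<in> arcs G \<and> x \<in> X \<and> \<pi> x = head G e then Some (\<phi> e x) else None)"
| "gen_act (Ghost e) x = (if e \<in> arcs G \<and> (\<exists>y\<in>X. \<pi> y = head G e \<and> \<phi> e y = x)
     then Some (THE y. y \<in> X \<and> \<pi> y = head G e \<and> \<phi> e y = x) else None)"

lemma gen_act_Ghost_iff:
  "gen_act (Ghost e) x = Some y \<longleftrightarrow> e \<in> arcs G \<and> y \<in> X \<and> \<pi> y = head G e \<and> \<phi> e y = x"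
proof -
  have the: "(THE y. y \<in> X \<and> \<pi> y = head G e \<and> \<phi> e y = x) = z"
    if "e \<in> arcs G" "z \<in> X" "\<pi> z = head G e" "\<phi> e z = x" for z
    using that by (intro the_equality) (blast intro: branch_inject(2))+
  show ?thesis
  proof (cases "e \<in> arcs G \<and> (\<exists>z\<in>X. \<pi> z = head G e \<and> \<phi> e z = x)")
    case True
    then obtain z where z: "e \<in> arcs G" "z \<in> X" "\<pi> z = head G e" "\<phi> e z = x" by blast
    have "gen_act (Ghost e) x = Some z"
      unfolding gen_act.simps the[OF z] using True by (rule if_P)
    then show ?thesis using z branch_inject(2)[of e y e z] by auto
  next
    case False
    then have "gen_act (Ghost e) x = None" unfolding gen_act.simps by (rule if_not_P)
    then show ?thesis using False by auto
  qed
qed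

lemma gen_act_Vertex_iff: "gen_act (Vertex v) x = Some y \<longleftrightarrow> x \<in> X \<and> \<pi> x = v \<and> y = x"
  and gen_act_Edge_iff:
    "gen_act (Edge e) x = Some y \<longleftrightarrow> e \<in> arcs G \<and> x \<in> X \<and> \<pi> x = head G e \<and> y = \<phi> e x"
  by auto

lemmas gen_act_iff = gen_act_Vertex_iff gen_act_Edge_iff gen_act_Ghost_iff

lemma gen_act_closed: "gen_act g x = Some y \<Longrightarrow> y \<in> X"
  by (cases g) (auto simp: gen_act_iff branch_in simp del: gen_act.simps)

text \<open>The rightmost letter acts first, so that concatenation of words becomes the product of
  matrices in the same order.\<close>
primrec word_act :: "('a, 'b) lpa_gen list \<Rightarrow> 'x \<Rightarrow> 'x option" where
  "word_act [] x = Some x"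
| "word_act (g # w) x = Option.bind (word_act w x) (gen_act g)"

lemma word_act_append: "word_act (u @ w) x = Option.bind (word_act w x) (word_act u)"
  by (induction u) simp_all

lemma word_act_closed: "word_act w x = Some y \<Longrightarrow> x \<in> X \<Longrightarrow> y \<in> X"
  by (induction w arbitrary: y) (auto simp: bind_eq_Some_conv dest: gen_act_closed)

definition act_matrix :: "('a, 'b, 'k::field) lpa_free \<Rightarrow> 'x \<Rightarrow> 'x \<Rightarrow> 'k" where
  "act_matrix p x y = (\<Sum>w\<in>Poly_Mapping.keys p.
     Poly_Mapping.lookup p w * (if word_act (letters w) y = Some x then 1 else 0))"

lemma act_matrix_superset:
  assumes "finite S" "Poly_Mapping.keys p \<subseteq> S"
  shows "act_matrix p x y
    = (\<Sum>w\<in>S. Poly_Mapping.lookup p w * (if word_act (letters w) y = Some x then 1 else 0))"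
  unfolding act_matrix_def using assms
  by (intro sum.mono_neutral_left) (auto simp: in_keys_iff)

lemma act_matrix_add: "act_matrix (p + q) x y = act_matrix p x y + act_matrix q x y"
  using keys_add[of p q]
  by (simp add: act_matrix_superset[of "Poly_Mapping.keys p \<union> Poly_Mapping.keys q"]
      lookup_add distrib_right sum.distrib)

lemma act_matrix_zero: "act_matrix 0 x y = 0"
  by (simp add: act_matrix_def)

lemma act_matrix_diff: "act_matrix (p - q) x y = act_matrix p x y - act_matrix q x y"
  using act_matrix_add[of "p - q" q x y] by simp

lemma act_matrix_sum: "act_matrix (\<Sum>i\<in>S. f i) x y = (\<Sum>i\<in>S. act_matrix (f i) x y)"
  by (induction S rule: infinite_finite_induct) (simp_all add: act_matrix_add act_matrix_zero)

lemma act_matrix_single: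
  "act_matrix (Poly_Mapping.single w c) x y = (if word_act (letters w) y = Some x then c else 0)"
  by (simp add: act_matrix_def)

lemma act_matrix_gen: "act_matrix (gen g) x y = (if gen_act g y = Some x then 1 else 0)"
  by (simp add: gen_def act_matrix_single)

lemma act_matrix_mult_single:
  assumes "z \<in> X"
  shows "act_matrix (Poly_Mapping.single u c * Poly_Mapping.single w d) x z
    = (\<Sum>y\<in>X. act_matrix (Poly_Mapping.single u c) x y * act_matrix (Poly_Mapping.single w d) y z)"
proof (cases "word_act (letters w) z")
  case None
  then show ?thesis by (simp add: mult_single act_matrix_single plus_fword_def word_act_append)
next
  case (Some y')
  then have "y' \<in> X" using assms word_act_closed by blast
  then have "(\<Sum>y\<in>X. act_matrix (Poly_Mapping.single u c) x y * act_matrix (Poly_Mapping.single w d) y z)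
      = act_matrix (Poly_Mapping.single u c) x y' * d"
    using finite_points
    by (subst sum.remove[of X y']) (auto simp: act_matrix_single Some split: if_splits intro!: sum.neutral)
  then show ?thesis
    by (simp add: mult_single act_matrix_single plus_fword_def word_act_append Some)
qed

lemma act_matrix_mult:
  assumes "z \<in> X"
  shows "act_matrix (p * q) x z = (\<Sum>y\<in>X. act_matrix p x y * act_matrix q y z)"
proof -
  let ?P = "Poly_Mapping.keys p" and ?Q = "Poly_Mapping.keys q"
  let ?p = "\<lambda>u. Poly_Mapping.single u (Poly_Mapping.lookup p u)"
  let ?q = "\<lambda>w. Poly_Mapping.single w (Poly_Mapping.lookup q w)"
  have p: "p = (\<Sum>u\<in>?P. ?p u)" and q: "q = (\<Sum>w\<in>?Q. ?q w)" by (rule poly_mapping_sum_single)+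
  have "act_matrix (p * q) x z = act_matrix ((\<Sum>u\<in>?P. ?p u) * (\<Sum>w\<in>?Q. ?q w)) x z"
    using p q by simp
  also have "\<dots> = (\<Sum>u\<in>?P. \<Sum>w\<in>?Q. \<Sum>y\<in>X. act_matrix (?p u) x y * act_matrix (?q w) y z)"
    by (simp only: sum_product act_matrix_sum act_matrix_mult_single[OF assms])
  also have "\<dots> = (\<Sum>y\<in>X. \<Sum>u\<in>?P. \<Sum>w\<in>?Q. act_matrix (?p u) x y * act_matrix (?q w) y z)"
    by (simp only: sum.swap[of _ X])
  also have "\<dots> = (\<Sum>y\<in>X. act_matrix (\<Sum>u\<in>?P. ?p u) x y * act_matrix (\<Sum>w\<in>?Q. ?q w) y z)"
    by (simp only: sum_product act_matrix_sum)
  also have "\<dots> = (\<Sum>y\<in>X. act_matrix p x y * act_matrix q y z)"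
    using p q by simp
  finally show ?thesis .
qed

lemma act_matrix_gen_mult:
  "act_matrix (gen g * gen g') x z
    = (if Option.bind (gen_act g' z) (gen_act g) = Some x then 1 else 0)"
  by (simp add: gen_def mult_single act_matrix_single plus_fword_def)

lemma act_matrix_if: "act_matrix (if P then p else 0) x y = (if P then act_matrix p x y else 0)"
  by (simp add: act_matrix_zero)

text \<open>The relation \<open>e\<^sup>* f = \<delta> r(e)\<close> holds because the maps \<open>\<phi> e\<close> are injective with
  disjoint images, and the relation at a regular vertex because these images cover its fibre. The other
  relations only express between which fibres the generators map.\<close>
lemma act_matrix_relator:
  assumes "p \<in> lpa_relators G"
  shows "act_matrix p x z = (0 :: 'k::field)"
  using assms
proof cases
  case (regular v)
  have edge: "Option.bind (gen_act (Ghost e) z) (gen_act (Edge e)) = Some x \<longleftrightarrow>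
      x = z \<and> (\<exists>y\<in>X. \<pi> y = head G e \<and> \<phi> e y = z)" if "e \<in> out_arcs G v" for e
    using that by (auto simp: bind_eq_Some_conv gen_act_iff simp del: gen_act.simps)
  have "(\<Sum>e\<in>out_arcs G v. act_matrix (gen (Edge e) * gen (Ghost e)) x z)
      = (\<Sum>e\<in>out_arcs G v. if x = z \<and> (\<exists>y\<in>X. \<pi> y = head G e \<and> \<phi> e y = z) then 1 else 0 :: 'k)"
    by (intro sum.cong refl) (simp only: act_matrix_gen_mult edge)
  also have "\<dots> = (if z \<in> X \<and> \<pi> z = v \<and> x = z then 1 else 0)"
  proof (cases "z \<in> X \<and> \<pi> z = v \<and> x = z")
    case True
    with regular(2) obtain e' y' where
      e': "e' \<in> out_arcs G v" "y' \<in> X" "\<pi> y' = head G e'" "\<phi> e' y' = z"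
      using branch_exists[of z] by auto
    \<comment> \<open>Exactly one edge leaving \<open>v\<close> has \<open>z\<close> in its image, so exactly one summand is \<open>1\<close>.\<close>
    have unique: "(\<exists>y\<in>X. \<pi> y = head G e \<and> \<phi> e y = z) \<longleftrightarrow> e = e'" if "e \<in> out_arcs G v" for e
      using that e' branch_inject(1)[of e _ e' y'] by auto
    have "(\<Sum>e\<in>out_arcs G v. if x = z \<and> (\<exists>y\<in>X. \<pi> y = head G e \<and> \<phi> e y = z) then 1 else 0)
        = (\<Sum>e\<in>out_arcs G v. if e = e' then 1 else 0 :: 'k)"
      using True by (intro sum.cong refl) (simp only: unique simp_thms)
    also have "\<dots> = 1"
      using e'(1) regular(2) by (simp add: regular_vertex_def)
    finally show ?thesis by (simp only: True simp_thms if_True)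
  next
    case False
    then show ?thesis by (auto simp: branch_in intro!: sum.neutral)
  qed
  finally show ?thesis
    by (simp only: regular(1) act_matrix_diff act_matrix_sum act_matrix_gen gen_act_iff)
      (auto)
next
  case (ghost_edge e f)
  have ghost_edge_iff: "Option.bind (gen_act (Edge f) z) (gen_act (Ghost e)) = Some x \<longleftrightarrow>
      e = f \<and> z \<in> X \<and> \<pi> z = head G e \<and> x = z"
    unfolding bind_eq_Some_conv gen_act_iff using ghost_edge(2,3) branch_inject by blast
  show ?thesis
    by (simp only: ghost_edge(1) act_matrix_diff act_matrix_gen_mult act_matrix_if act_matrix_gen
        ghost_edge_iff gen_act_iff) auto
qed (auto simp: act_matrix_diff act_matrix_gen_mult act_matrix_gen act_matrix_if branch_in
      bind_eq_Some_conv gen_act_iff simp del: gen_act.simps)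

lemma act_matrix_ideal:
  assumes "p \<in> (IG :: ('a, 'b, 'k::field) lpa_free set)" "x \<in> X" "z \<in> X"
  shows "act_matrix p x z = 0"
proof -
  let ?J = "{p \<in> FG. \<forall>x\<in>X. \<forall>z\<in>X. act_matrix p x z = 0} :: ('a, 'b, 'k) lpa_free set"
  have "algebra_ideal FG ?J"
    unfolding algebra_ideal_def
    by (auto simp: act_matrix_zero act_matrix_add act_matrix_mult intro: free_algebra_intros)
  moreover have "lpa_relators G \<subseteq> ?J"
    using lpa_relators_subset act_matrix_relator by auto
  ultimately have "IG \<subseteq> ?J" unfolding lpa_ideal_def by (metis (no_types, lifting) hull_minimal)
  then show ?thesis using assms by blast
qed

text \<open>The matrix of a residue class is that of any representative, because the ideal acts by zero.\<close>
definition lpa_matrix :: "('a, 'b, 'k::field) lpa_free set \<Rightarrow> 'x \<Rightarrow> 'x \<Rightarrow> 'k" where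
  "lpa_matrix C = act_matrix (SOME p. p \<in> C)"

lemma lpa_matrix_class:
  assumes "p \<in> FG" "x \<in> X" "z \<in> X"
  shows "lpa_matrix (lpa_class G p) x z = act_matrix p x z"
proof -
  have "(SOME q. q \<in> lpa_class G p) \<in> lpa_class G p"
    using lpa_class_self[OF assms(1)] by (rule someI[where P = "\<lambda>q. q \<in> lpa_class G p"])
  then have "(SOME q. q \<in> lpa_class G p) - p \<in> IG" by (simp add: lpa_class_def)
  from act_matrix_ideal[OF this assms(2,3)] show ?thesis
    by (simp add: lpa_matrix_def act_matrix_diff)
qed

text \<open>The unit acts as the identity because every point lies over exactly one vertex.\<close>
lemma matrix_representation_lpa:
  "matrix_representation (leavitt_path_algebra TYPE('k::field) G) X lpa_matrix"
proof (intro matrix_representation.intro matrix_representation_axioms.intro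
    ring_leavitt_path_algebra finite_points points_nonempty)
  let ?R = "leavitt_path_algebra TYPE('k) G"
  fix a b :: "('a, 'b, 'k) lpa_free set" and x z
  assume "a \<in> carrier ?R" "b \<in> carrier ?R" and xz: "x \<in> X" "z \<in> X"
  then obtain p q where pq: "p \<in> FG" "q \<in> FG" "a = lpa_class G p" "b = lpa_class G q"
    by (auto simp: lpa_carrier)
  show "lpa_matrix (a \<oplus>\<^bsub>?R\<^esub> b) x z = lpa_matrix a x z + lpa_matrix b x z"
    using pq xz by (simp add: lpa_class_add lpa_matrix_class free_algebra_add act_matrix_add)
  show "lpa_matrix (a \<otimes>\<^bsub>?R\<^esub> b) x z = (\<Sum>y\<in>X. lpa_matrix a x y * lpa_matrix b y z)"
    using pq xz by (simp add: lpa_class_mult lpa_matrix_class free_algebra_mult act_matrix_mult)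
next
  fix x y assume xy: "x \<in> X" "y \<in> X"
  have "lpa_matrix (lpa_class G vsum) x y = (\<Sum>v\<in>verts G. if \<pi> y = v then if x = y then 1 else 0 else 0 :: 'k)"
    unfolding lpa_matrix_class[OF vsum_free xy] act_matrix_sum act_matrix_gen gen_act_iff
    using xy by (intro sum.cong) auto
  then show "lpa_matrix \<one>\<^bsub>leavitt_path_algebra TYPE('k) G\<^esub> x y = (if x = y then 1 else 0 :: 'k)"
    using base_in_verts[OF xy(2)] by (simp add: lpa_one)
qed

theorem gr_IBN_lpa:
  "gr_IBN (leavitt_path_algebra TYPE('k::field) G) (A :: 'g::ab_group_add \<Rightarrow> _)"
  by (rule matrix_representation.gr_IBN[OF matrix_representation_lpa])

end

text \<open>The equation at a regular \<open>v\<close> says that a fibre with \<open>d v\<close> points over \<open>v\<close> is as large as the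
  disjoint union of the fibres over the heads of the edges leaving \<open>v\<close>. Any bijection between the
  two supplies the maps \<open>\<phi> e\<close>.\<close>
lemma (in fin_digraph) ex_branching_system:
  fixes d :: "'a \<Rightarrow> nat"
  assumes d: "\<And>v. regular_vertex G v \<Longrightarrow> d v = (\<Sum>e\<in>out_arcs G v. d (head G e))"
    and w: "w \<in> verts G" "d w \<noteq> 0"
  shows "\<exists>\<phi>. branching_system G (SIGMA v:verts G. {..<d v}) fst \<phi>"
proof -
  let ?X = "SIGMA v:verts G. {..<d v}"
  let ?Y = "\<lambda>v. SIGMA e:out_arcs G v. {x \<in> ?X. fst x = head G e}"
  have fin: "finite ?X" by simp
  have fiber: "{x \<in> ?X. fst x = v} = {v} \<times> {..<d v}" if "v \<in> verts G" for v
    using that by auto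
  have "\<exists>b. bij_betw b (?Y v) {x \<in> ?X. fst x = v}" if v: "regular_vertex G v" for v
  proof (rule finite_same_card_bij)
    have v': "v \<in> verts G" "finite (out_arcs G v)" using v by (auto simp: regular_vertex_def)
    show "finite (?Y v)" using v' fin by (intro finite_SigmaI) auto
    show "finite {x \<in> ?X. fst x = v}" using fin by simp
    have "card (?Y v) = (\<Sum>e\<in>out_arcs G v. card {x \<in> ?X. fst x = head G e})"
      using v' fin by (intro card_SigmaI) auto
    also have "\<dots> = (\<Sum>e\<in>out_arcs G v. d (head G e))"
      by (intro sum.cong refl) (simp add: fiber card_cartesian_product)
    finally show "card (?Y v) = card {x \<in> ?X. fst x = v}"
      by (simp add: d[OF v] fiber[OF v'(1)] card_cartesian_product)
  qed
  then have "\<exists>b. \<forall>v. regular_vertex G v \<longrightarrow> bij_betw (b v) (?Y v) {x \<in> ?X. fst x = v}"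
    by (intro choice) blast
  then obtain b where b: "\<And>v. regular_vertex G v \<Longrightarrow> bij_betw (b v) (?Y v) {x \<in> ?X. fst x = v}"
    by blast
  have "branching_system G ?X fst (\<lambda>e x. b (tail G e) (e, x))"
  proof (intro branching_system.intro branching_system_axioms.intro fin_digraph fin)
    show "?X \<noteq> {}" using w by auto
    fix v assume v: "regular_vertex G v"
    show "bij_betw (\<lambda>(e, x). b (tail G e) (e, x)) (?Y v) {x \<in> ?X. fst x = v}"
      by (rule bij_betw_cong[THEN iffD1, OF _ b[OF v]]) auto
  qed auto
  then show ?thesis by blast
qed

section \<open>Recurrent arcs and disjoint cycles\<close>

context fin_digraph
begin

text \<open>An arc is recurrent when it does not leave the strongly connected component of its tail.\<close>
definition recurrent :: "'b \<Rightarrow> bool" where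
  "recurrent e \<longleftrightarrow> e \<in> arcs G \<and> head G e \<rightarrow>\<^sup>* tail G e"

text \<open>A path without repeated vertices leads from the head of the arc back to its tail.\<close>
lemma recurrent_arc_on_cycle:
  assumes "recurrent a"
  obtains p where "cycle p" "a \<in> set p" "distinct (map (tail G) p)"
proof -
  obtain q where q: "apath (head G a) q (tail G a)"
    using assms reachable_apath by (auto simp: recurrent_def)
  have a: "a \<in> arcs G" using assms by (simp add: recurrent_def)
  have walk: "awalk (tail G a) (a # q) (tail G a)"
    using q a by (simp add: awalk_Cons_iff apath_def)
  have d: "distinct (awalk_verts (head G a) q)" using q by (simp add: apath_def)
  have "cycle (a # q)" unfolding cycle_def using walk d by (intro exI[of _ "tail G a"]) simp
  moreover have "distinct (map (tail G) (a # q))"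
  proof (cases "q = []")
    case False
    have "head G (last q) = tail G a"
      using q False by (auto simp: apath_def awalk_verts_conv dest!: awlast_of_awalk)
    then show ?thesis using d False by (auto simp: awalk_verts_conv)
  qed simp
  ultimately show ?thesis using that by simp
qed

text \<open>Two recurrent arcs with the same tail lie on cycles through a common vertex, which therefore
  are the same cycle; but a cycle leaves each of its vertices by a single arc. So the walks that stay
  inside a strongly connected component are deterministic.\<close>
lemma unique_recurrent_arc:
  assumes disjoint: "\<And>v C D. \<lbrakk>v \<in> verts G; C \<in> cycle_subgraphs G; D \<in> cycle_subgraphs G;
      v \<in> verts C; v \<in> verts D\<rbrakk> \<Longrightarrow> C = D"
    and a: "recurrent a" and b: "recurrent b" and ab: "tail G a = tail G b"
  shows "a = b"
proof -
  let ?C = "\<lambda>p. \<lparr>verts = tail G ` set p, arcs = set p, tail = tail G, head = head G\<rparr>"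
  obtain p where p: "cycle p" "a \<in> set p" "distinct (map (tail G) p)"
    by (rule recurrent_arc_on_cycle[OF a])
  obtain q where q: "cycle q" "b \<in> set q"
    by (rule recurrent_arc_on_cycle[OF b])
  have "?C p = ?C q"
  proof (rule disjoint[of "tail G a"])
    show "tail G a \<in> verts G" using a by (simp add: recurrent_def)
    show "?C p \<in> cycle_subgraphs G" "?C q \<in> cycle_subgraphs G"
      using p q by (auto simp: cycle_subgraphs_def)
    show "tail G a \<in> verts (?C p)" using p by simp
    show "tail G a \<in> verts (?C q)" using q by (simp add: ab)
  qed
  then have "b \<in> set p" using q by simp
  then show "a = b" using p ab by (auto simp: distinct_map dest: inj_onD)
qed

text \<open>If there are cycles, \<open>w\<close> is chosen on one that is reached from as few vertices on
  closed walks as possible, so that every closed walk leading to \<open>w\<close> can be reached from \<open>w\<close>. If there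
  are none, \<open>w\<close> is a vertex that reaches as few others as possible, hence a sink.\<close>
lemma ex_source_component:
  assumes "verts G \<noteq> {}"
  obtains w where "w \<in> verts G" "out_arcs G w = {} \<or> w \<rightarrow>\<^sup>+ w"
    "\<And>u. \<lbrakk>u \<rightarrow>\<^sup>+ u; u \<rightarrow>\<^sup>* w\<rbrakk> \<Longrightarrow> w \<rightarrow>\<^sup>* u"
proof (cases "\<exists>u. u \<rightarrow>\<^sup>+ u")
  case True
  let ?S = "\<lambda>w. {u. u \<rightarrow>\<^sup>+ u \<and> u \<rightarrow>\<^sup>* w}"
  have fin: "finite (?S w)" for w
    by (rule finite_subset[OF _ finite_verts]) (auto intro: reachable_in_verts)
  obtain w where w: "w \<rightarrow>\<^sup>+ w" "\<And>u. u \<rightarrow>\<^sup>+ u \<Longrightarrow> card (?S w) \<le> card (?S u)"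
    using True ex_has_least_nat[of "\<lambda>u. u \<rightarrow>\<^sup>+ u" _ "\<lambda>w. card (?S w)"] by blast
  have "w \<rightarrow>\<^sup>* u" if u: "u \<rightarrow>\<^sup>+ u" "u \<rightarrow>\<^sup>* w" for u
  proof -
    have "?S u \<subseteq> ?S w" using u(2) by (auto intro: reachable_trans)
    then have "?S u = ?S w" using fin w(2)[OF u(1)] by (intro card_seteq)
    moreover have "w \<in> ?S w" using w(1) reachable1_reachable[OF w(1)] by blast
    ultimately show ?thesis by blast
  qed
  with reachable1_in_verts(1)[OF w(1)] w(1) show ?thesis by (blast intro: that[of w])
next
  case False
  let ?S = "\<lambda>w. {u. w \<rightarrow>\<^sup>+ u}"
  have fin: "finite (?S w)" for w
    by (rule finite_subset[OF _ finite_verts]) (auto intro: reachable1_in_verts)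
  obtain w where w: "w \<in> verts G" "\<And>u. u \<in> verts G \<Longrightarrow> card (?S w) \<le> card (?S u)"
    using assms ex_has_least_nat[of "\<lambda>u. u \<in> verts G" _ "\<lambda>w. card (?S w)"] by blast
  have "out_arcs G w = {}"
  proof (rule ccontr)
    assume "out_arcs G w \<noteq> {}"
    then obtain e where "e \<in> out_arcs G w" by blast
    then have e: "e \<in> arcs G" "tail G e = w" by simp_all
    define y where "y = head G e"
    have y: "w \<rightarrow> y" using e by (auto simp: y_def arcs_ends_conv)
    have "?S y \<subset> ?S w" using y False by (auto intro: trancl_into_trancl2)
    then have "card (?S y) < card (?S w)" using fin by (rule psubset_card_mono[rotated])
    moreover have "card (?S w) \<le> card (?S y)" using w(2) y adj_in_verts by blast
    ultimately show False by simp
  qed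
  then show ?thesis using w(1) False by (intro that[of w]) auto
qed

text \<open>Here \<open>d v\<close> is the number of walks from \<open>v\<close> to \<open>w\<close> that meet \<open>w\<close> only at their end. Splitting off the
  first arc gives the equation at every \<open>v \<noteq> w\<close>. At \<open>w\<close> itself, if \<open>w\<close> is on a cycle, the equation
  says that there is exactly one first return to \<open>w\<close>, and this holds because a walk in the component
  of \<open>w\<close> is deterministic. The recursion over the first arc defines \<open>d\<close> once it is known to be
  well-founded: a closed walk that avoids \<open>w\<close> and leads to \<open>w\<close> would lie in the component of \<open>w\<close>,
  and since walks there are deterministic it could never leave itself to reach \<open>w\<close>.\<close>
lemma ex_dimension_function:
  assumes unique: "\<And>a b. \<lbrakk>recurrent a; recurrent b; tail G a = tail G b\<rbrakk> \<Longrightarrow> a = b"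
    and w: "w \<in> verts G" "out_arcs G w = {} \<or> w \<rightarrow>\<^sup>+ w"
    and source: "\<And>u. \<lbrakk>u \<rightarrow>\<^sup>+ u; u \<rightarrow>\<^sup>* w\<rbrakk> \<Longrightarrow> w \<rightarrow>\<^sup>* u"
  shows "\<exists>d :: 'a \<Rightarrow> nat. d w = 1 \<and>
    (\<forall>v. regular_vertex G v \<longrightarrow> d v = (\<Sum>e\<in>out_arcs G v. d (head G e)))"
proof -
  define r where "r = {(y, x). x \<rightarrow> y \<and> x \<noteq> w \<and> y \<rightarrow>\<^sup>* w}"
  have "acyclic r"
  proof (rule acyclicI, intro allI notI)
    fix x assume x: "(x, x) \<in> r\<^sup>+"
    have sub: "r\<inverse> \<subseteq> arcs_ends G" by (auto simp: r_def)
    have "(x, x) \<in> (r\<inverse>)\<^sup>+" using x by (simp add: trancl_converse)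
    then have xx: "x \<rightarrow>\<^sup>+ x" using trancl_mono[OF _ sub] by blast
    obtain y where "(x, y) \<in> r" using x by (blast elim: converse_tranclE)
    then have xw: "x \<rightarrow>\<^sup>* w" by (simp add: r_def)
    have wx: "w \<rightarrow>\<^sup>* x" using source[OF xx xw] .
    \<comment> \<open>The vertices on closed walks through \<open>x\<close> that avoid \<open>w\<close>. Any arc from \<open>S\<close> towards \<open>w\<close> is
      recurrent, hence is the arc along which such a walk continues, and so stays in \<open>S\<close>.\<close>
    define S where "S = {y. (y, x) \<in> r\<^sup>* \<and> (x, y) \<in> r\<^sup>*}"
    have reach: "x \<rightarrow>\<^sup>* y" if "y \<in> S" for y
    proof -
      have "(x, y) \<in> (r\<inverse>)\<^sup>*" using that by (simp add: S_def rtrancl_converse)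
      then have "(x, y) \<in> (arcs_ends G)\<^sup>*" using rtrancl_mono[OF sub] by blast
      then show ?thesis using reachable_conv' reachable_in_verts(1)[OF xw] by blast
    qed
    have next_in_S: "\<exists>z\<in>S. (z, y) \<in> r" if "y \<in> S" for y
    proof -
      have "(y, y) \<in> r\<^sup>+" using that x by (auto simp: S_def intro: rtrancl_trancl_trancl trancl_rtrancl_trancl)
      then obtain z where "(y, z) \<in> r\<^sup>*" "(z, y) \<in> r" by (blast dest: tranclD2)
      then show ?thesis using that
        by (auto simp: S_def intro!: bexI[of _ z] intro: converse_rtrancl_into_rtrancl rtrancl_trans)
    qed
    have "w \<in> S" if "y \<rightarrow>\<^sup>* w" "y \<in> S" for y
      using that
    proof (induction rule: converse_reachable_induct)
      case (step y z)
      obtain z' where z': "z' \<in> S" "(z', y) \<in> r" using next_in_S step.prems by blast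
      obtain a where a: "a \<in> arcs G" "tail G a = y" "head G a = z" using step.hyps(1) by blast
      obtain b where b: "b \<in> arcs G" "tail G b = y" "head G b = z'"
        using z'(2) by (auto simp: r_def)
      have wy: "w \<rightarrow>\<^sup>* y" using wx reach[OF step.prems] by (rule reachable_trans)
      have "recurrent a" "recurrent b"
        using a b z'(2) step.hyps(2) wy by (auto simp: recurrent_def r_def intro: reachable_trans)
      then have "a = b" using unique a b by simp
      then show ?case using step.IH a b z' by simp
    qed
    then have "w \<in> S" using xw by (auto simp: S_def)
    then show False using next_in_S by (auto simp: r_def)
  qed
  moreover have "finite r"
    by (rule finite_subset[of _ "verts G \<times> verts G"]) (auto simp: r_def adj_in_verts)
  ultimately have wf: "wf r" by (simp add: finite_acyclic_wf)
  define F where "F d x = (if x = w then 1 else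
      \<Sum>e\<in>out_arcs G x. if head G e \<rightarrow>\<^sup>* w then d (head G e) else 0)" for d :: "'a \<Rightarrow> nat" and x
  define d where "d = wfrec r F"
  have d_eq: "d x = F d x" for x
  proof -
    have "d x = F (cut d r x) x" unfolding d_def by (rule wfrec[OF wf])
    also have "\<dots> = F d x"
      by (auto simp: F_def cut_apply r_def arcs_ends_conv intro!: sum.cong)
    finally show ?thesis .
  qed
  have d_w: "d w = 1" by (simp add: d_eq F_def)
  have zero: "d y = 0" if "\<not> y \<rightarrow>\<^sup>* w" for y
  proof -
    have "y \<noteq> w" using that w(1) by auto
    moreover have "\<not> head G e \<rightarrow>\<^sup>* w" if "e \<in> out_arcs G y" for e
      using that \<open>\<not> y \<rightarrow>\<^sup>* w\<close> adj_reachable_trans[of y "head G e" w] by (auto simp: arcs_ends_conv)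
    ultimately show ?thesis by (simp add: d_eq[of y] F_def)
  qed
  have sum: "d x = (\<Sum>e\<in>out_arcs G x. d (head G e))" if "x \<noteq> w" for x
    using that zero by (subst d_eq) (auto simp: F_def intro!: sum.cong)
  \<comment> \<open>Inside the component of \<open>w\<close> only the recurrent arc contributes.\<close>
  have single: "(\<Sum>e\<in>out_arcs G x. d (head G e)) = d (head G a)"
    if a: "a \<in> out_arcs G x" "head G a \<rightarrow>\<^sup>* w" and wx: "w \<rightarrow>\<^sup>* x" for a x
  proof -
    have "d (head G e) = 0" if e: "e \<in> out_arcs G x - {a}" for e
    proof (rule zero, rule notI)
      assume "head G e \<rightarrow>\<^sup>* w"
      then have "recurrent e" "recurrent a"
        using e a wx by (auto simp: recurrent_def intro: reachable_trans)
      then show False using unique[of e a] e a by simp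
    qed
    then have "(\<Sum>e\<in>out_arcs G x - {a}. d (head G e)) = 0" by (rule sum.neutral[OF ballI])
    moreover have "finite (out_arcs G x)" by (rule finite_subset[OF _ finite_arcs]) auto
    ultimately show ?thesis using sum.remove[OF _ a(1), of "\<lambda>e. d (head G e)"] by simp
  qed
  have one: "d y = 1" if "y \<rightarrow>\<^sup>* w" "w \<rightarrow>\<^sup>* y" for y
    using that
  proof (induction rule: converse_reachable_induct)
    case base
    show ?case by (rule d_w)
  next
    case (step x y)
    show ?case
    proof (cases "x = w")
      case False
      obtain a where a: "a \<in> out_arcs G x" "head G a = y"
        using step.hyps(1) by (auto simp: arcs_ends_conv)
      have "d x = d y" using sum[OF False] single[of a x] a step by simp
      moreover have "w \<rightarrow>\<^sup>* y" using step by (blast intro: reachable_adj_trans)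
      ultimately show ?thesis using step.IH by simp
    qed (simp add: d_w)
  qed
  have "d v = (\<Sum>e\<in>out_arcs G v. d (head G e))" if v: "regular_vertex G v" for v
  proof (cases "v = w")
    case True
    then have "w \<rightarrow>\<^sup>+ w" using w(2) v by (auto simp: regular_vertex_def)
    then obtain y where y: "w \<rightarrow> y" "(y, w) \<in> (arcs_ends G)\<^sup>*" by (blast dest: tranclD)
    have yw: "y \<rightarrow>\<^sup>* w" using y adj_in_verts(2)[OF y(1)] by (simp add: reachable_conv')
    obtain a where a: "a \<in> out_arcs G w" "head G a = y" using y(1) by (auto simp: arcs_ends_conv)
    show ?thesis using single[of a w] a yw w(1) one[OF yw] y(1) d_w True by simp
  qed (rule sum)
  then show ?thesis using d_w by blast
qed

end

section \<open>Graded invariant basis number\<close>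

theorem corollary2p6:
  fixes E :: "('a, 'b) pre_digraph"
  assumes "fin_digraph E" and "verts E \<noteq> {}"
    and "\<And>v C D. \<lbrakk>v \<in> verts E; C \<in> cycle_subgraphs E; D \<in> cycle_subgraphs E;
            v \<in> verts C; v \<in> verts D\<rbrakk> \<Longrightarrow> C = D"
  shows "gr_IBN (leavitt_path_algebra TYPE('k::field) E) (lpa_component TYPE('k) E)"
proof -
  interpret fin_digraph E by (rule assms(1))
  obtain w where w: "w \<in> verts E" "out_arcs E w = {} \<or> w \<rightarrow>\<^sup>+\<^bsub>E\<^esub> w"
    "\<And>u. \<lbrakk>u \<rightarrow>\<^sup>+\<^bsub>E\<^esub> u; u \<rightarrow>\<^sup>*\<^bsub>E\<^esub> w\<rbrakk> \<Longrightarrow> w \<rightarrow>\<^sup>*\<^bsub>E\<^esub> u"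
    using ex_source_component[OF assms(2)] by blast
  have unique: "a = b" if "recurrent a" "recurrent b" "tail E a = tail E b" for a b
    using assms(3) that by (rule unique_recurrent_arc)
  obtain d :: "'a \<Rightarrow> nat" where "d w = 1"
    "\<And>v. regular_vertex E v \<Longrightarrow> d v = (\<Sum>e\<in>out_arcs E v. d (head E e))"
    using ex_dimension_function[OF unique w] by blast
  then obtain \<phi> where "branching_system E (SIGMA v:verts E. {..<d v}) fst \<phi>"
    using ex_branching_system[of d w] w(1) by auto
  then show ?thesis by (rule branching_system.gr_IBN_lpa)
qed

end
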